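(* For any compact metric space $B$, the convex set $\mathrm{Pr}^{\mathrm{Aff}(\mathbb{F}_2^\omega)}(B^{[[\mathbb{N}]]})$ of affine-exchangeable Borel probability measures on $B^{[[\mathbb{N}]]}$, equipped with the vague topology, is a Bauer simplex.
   Context: $[[\mathbb{N}]]$ is the set of sequences in $\{0,1\}^{\mathbb{N}}$ with finitely many non-zero coordinates, identified as a set with $\mathbb{F}_2^\omega=\bigoplus_{i\in\mathbb{N}}\mathbb{F}_2$. $\mathrm{Aff}(\mathbb{F}_2^\omega)$ is the group of invertible affine maps of $\mathbb{F}_2^\omega$. $\mathrm{Pr}^{\mathrm{Aff}(\mathbb{F}_2^\omega)}(B^{[[\mathbb{N}]]})$ is the set of Borel probability measures on $B^{[[\mathbb{N}]]}$ invariant under all coordinate permutations $(b_v)_v\mapsto(b_{\gamma(v)})_v$ with $\gamma\in\mathrm{Aff}(\mathbb{F}_2^\omega)$. The vague (= weak) topology is the topology of convergence of integrals of continuous functions on the compact space $B^{[[\mathbb{N}]]}$. A Bauer simplex is a (compact, Choquet) simplex whose set of extreme points is closed. *)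

theory Defs
  imports
    "HOL-Probability.Probability"
    "HOL-Library.Poly_Mapping"
    "HOL-Library.Z2"
    "HOL-Algebra.Lattice"
begin

section \<open>Choquet and Bauer simplices\<close>

definition locally_convex_topology :: "'v::real_vector topology \<Rightarrow> bool" where
  "locally_convex_topology T \<longleftrightarrow>
     topspace T = UNIV \<and> Hausdorff_space T \<and>
     continuous_map (prod_topology T T) T (\<lambda>(x, y). x + y) \<and>
     continuous_map (prod_topology euclideanreal T) T (\<lambda>(c, x). c *\<^sub>R x) \<and>
     (\<forall>U x. openin T U \<and> x \<in> U \<longrightarrow> (\<exists>V. openin T V \<and> convex V \<and> x \<in> V \<and> V \<subseteq> U))"

text \<open>
  Choquet's definition: a compact convex set \<open>K\<close> in a locally convex Hausdorff space \<open>E\<close> is a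
  simplex if, placing it as \<open>K \<times> {1}\<close> in \<open>E \<times> \<real>\<close>, the vector space \<open>P - P\<close> spanned by the cone
  \<open>P = {(t x, t). t \<ge> 0, x \<in> K}\<close> is a lattice for the order \<open>x \<le> y \<longleftrightarrow> y - x \<in> P\<close>.
  (Passing to \<open>K \<times> {1}\<close> avoids assuming that \<open>K\<close> lies in a hyperplane missing the origin.)
\<close>

definition simplex_cone :: "'v::real_vector set \<Rightarrow> ('v \<times> real) set" where
  "simplex_cone K = cone hull (K \<times> {1})"

definition choquet_simplex :: "'v::real_vector topology \<Rightarrow> 'v set \<Rightarrow> bool" where
  "choquet_simplex T K \<longleftrightarrow>
     locally_convex_topology T \<and> K \<noteq> {} \<and> convex K \<and> compactin T K \<and>
     Lattice.lattice
       \<lparr>carrier = {x - y | x y. x \<in> simplex_cone K \<and> y \<in> simplex_cone K},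
        eq = (=),
        le = (\<lambda>x y. y - x \<in> simplex_cone K)\<rparr>"

definition bauer_simplex :: "'v::real_vector topology \<Rightarrow> 'v set \<Rightarrow> bool" where
  "bauer_simplex T K \<longleftrightarrow> choquet_simplex T K \<and> closedin T {x. x extreme_point_of K}"


section \<open>Affine-exchangeable measures\<close>

type_synonym f2_omega = "nat \<Rightarrow>\<^sub>0 bit"

definition f2_scale :: "bit \<Rightarrow> f2_omega \<Rightarrow> f2_omega" where
  "f2_scale c = Poly_Mapping.map (\<lambda>a. c * a)"

lemma lookup_f2_scale [simp]:
  "Poly_Mapping.lookup (f2_scale c v) i = c * Poly_Mapping.lookup v i"
  unfolding f2_scale_def by transfer (simp add: when_def)

lemma vector_space_f2_scale: "vector_space f2_scale"
  by unfold_locales (rule poly_mapping_eqI, simp only: lookup_f2_scale lookup_add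
      distrib_left distrib_right mult.assoc mult_1)+

instance bit :: countable
  by (rule countable_classI[of "case_bit 0 1"]) (auto split: bit.splits)

instance poly_mapping :: (countable, "{countable, zero}") countable
proof
  have inj: "inj (\<lambda>p :: 'a \<Rightarrow>\<^sub>0 'b. (\<lambda>k. (k, Poly_Mapping.lookup p k)) ` Poly_Mapping.keys p)"
  proof (rule injI, rule poly_mapping_eqI)
    fix p q :: "'a \<Rightarrow>\<^sub>0 'b" and k
    assume "(\<lambda>k. (k, Poly_Mapping.lookup p k)) ` Poly_Mapping.keys p =
      (\<lambda>k. (k, Poly_Mapping.lookup q k)) ` Poly_Mapping.keys q"
    then have "k \<in> Poly_Mapping.keys p \<and> v = Poly_Mapping.lookup p k \<longleftrightarrow>
        k \<in> Poly_Mapping.keys q \<and> v = Poly_Mapping.lookup q k" for v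
      by (auto simp: set_eq_iff image_iff)
    then show "Poly_Mapping.lookup p k = Poly_Mapping.lookup q k"
      by (metis in_keys_iff)
  qed
  have "countable {A :: ('a \<times> 'b) set. finite A \<and> A \<subseteq> UNIV}"
    by (rule countable_Collect_finite_subset) simp
  then have "countable (range (\<lambda>p :: 'a \<Rightarrow>\<^sub>0 'b. (\<lambda>k. (k, Poly_Mapping.lookup p k)) ` Poly_Mapping.keys p))"
    by (rule countable_subset[rotated]) auto
  then have "countable (UNIV :: ('a \<Rightarrow>\<^sub>0 'b) set)"
    using inj by (rule countable_image_inj_on)
  then show "\<exists>f :: ('a \<Rightarrow>\<^sub>0 'b) \<Rightarrow> nat. inj f"
    by (auto simp: countable_def)
qed

definition aff_f2_omega :: "(f2_omega \<Rightarrow> f2_omega) set" where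
  "aff_f2_omega =
     {\<gamma>. bij \<gamma> \<and> (\<exists>L c. Vector_Spaces.linear f2_scale f2_scale L \<and> \<gamma> = (\<lambda>v. L v + c))}"

definition affine_exchangeable :: "(f2_omega \<Rightarrow> 'b::topological_space) measure set" where
  "affine_exchangeable =
     {\<mu>. prob_space \<mu> \<and> sets \<mu> = sets borel \<and>
         (\<forall>\<gamma>\<in>aff_f2_omega. distr \<mu> borel (\<lambda>b v. b (\<gamma> v)) = \<mu>)}"


section \<open>The vague topology\<close>

text \<open>
  The type \<^typ>\<open>'a measure\<close> carries no vector space structure, so a Borel probability measure
  \<open>\<mu>\<close> is identified with the functional \<open>f \<mapsto> \<integral> f d\<mu>\<close> in the dual of the space of bounded
  continuous functions (all continuous functions, if the space is compact). The identification
  is affine, and on metric spaces it is injective (\<open>inj_on_integral_functional\<close> below); the vague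
  topology is the one induced by the weak-* topology of the dual. The library's strong operator
  topology, i.e. pointwise convergence of operators, is the weak-* topology when the operators
  are real-valued.
\<close>

definition integral_functional :: "'a::topological_space measure \<Rightarrow> ('a \<Rightarrow>\<^sub>C real) \<Rightarrow>\<^sub>L real" where
  "integral_functional \<mu> = Blinfun (\<lambda>f. \<integral>x. apply_bcontfun f x \<partial>\<mu>)"

abbreviation vague_topology :: "(('a::topological_space \<Rightarrow>\<^sub>C real) \<Rightarrow>\<^sub>L real) topology" where
  "vague_topology \<equiv> strong_operator_topology"

lemma integrable_bcontfun:
  fixes f :: "'a::topological_space \<Rightarrow>\<^sub>C real"
  assumes "finite_measure \<mu>" "sets \<mu> = sets borel"
  shows "integrable \<mu> (apply_bcontfun f)"
proof -
  interpret finite_measure \<mu> by fact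
  have "apply_bcontfun f \<in> borel_measurable borel"
    by (intro borel_measurable_continuous_onI continuous_on_apply_bcontfun)
  then have m: "apply_bcontfun f \<in> borel_measurable \<mu>"
    using measurable_cong_sets[OF assms(2) refl] by blast
  show ?thesis
    using norm_bounded[of f] by (intro integrable_const_bound[where B = "norm f"] m) auto
qed

lemma integral_functional_apply:
  fixes f :: "'a::topological_space \<Rightarrow>\<^sub>C real"
  assumes "finite_measure \<mu>" "sets \<mu> = sets borel"
  shows "blinfun_apply (integral_functional \<mu>) f = (\<integral>x. apply_bcontfun f x \<partial>\<mu>)"
proof -
  interpret finite_measure \<mu> by fact
  note int = integrable_bcontfun[OF assms]
  have bound: "\<bar>\<integral>x. apply_bcontfun g x \<partial>\<mu>\<bar> \<le> norm g * measure \<mu> (space \<mu>)"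
    for g :: "'a \<Rightarrow>\<^sub>C real"
  proof -
    have "\<bar>\<integral>x. apply_bcontfun g x \<partial>\<mu>\<bar> \<le> (\<integral>x. \<bar>apply_bcontfun g x\<bar> \<partial>\<mu>)"
      by (rule integral_abs_bound)
    also have "\<dots> \<le> (\<integral>x. norm g \<partial>\<mu>)"
      using norm_bounded[of g] by (intro integral_mono integrable_abs int) auto
    finally show ?thesis by (simp add: mult.commute)
  qed
  have "bounded_linear (\<lambda>f :: 'a \<Rightarrow>\<^sub>C real. \<integral>x. apply_bcontfun f x \<partial>\<mu>)"
    by (rule bounded_linear_intro[where K = "measure \<mu> (space \<mu>)"])
      (use bound int in auto)
  then show ?thesis
    unfolding integral_functional_def by (simp add: bounded_linear_Blinfun_apply)
qed

lemma inj_on_integral_functional: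
  "inj_on integral_functional
     {\<mu> :: 'a::metric_space measure. prob_space \<mu> \<and> sets \<mu> = sets borel}"
proof (rule inj_onI, clarify)
  fix M N :: "'a measure"
  assume M: "prob_space M" "sets M = sets borel" and N: "prob_space N" "sets N = sets borel"
    and eq: "integral_functional M = integral_functional N"
  have fin: "finite_measure M" "finite_measure N"
    using M N by (auto dest: prob_space.finite_measure)
  have sp: "space M = UNIV" "space N = UNIV"
    using M N by (auto dest: sets_eq_imp_space_eq)
  have ints: "(\<integral>x. f x \<partial>M) = (\<integral>x. f x \<partial>N)" if "f \<in> bcontfun" for f :: "'a \<Rightarrow> real"
    using integral_functional_apply[OF fin(1) M(2), of "Bcontfun f"]
      integral_functional_apply[OF fin(2) N(2), of "Bcontfun f"] eq that
    by (simp add: Bcontfun_inverse)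
  have closed_eq: "measure M C = measure N C" if C: "closed C" "C \<noteq> {}" for C
  proof -
    define g where "g = (\<lambda>n x. max 0 (1 - real n * infdist x C))"
    have contg: "continuous_on UNIV (g n)" for n
      unfolding g_def by (intro continuous_intros)
    have bg: "\<bar>g n x\<bar> \<le> 1" for n x
      unfolding g_def using infdist_nonneg[of x C] by auto
    have gb: "g n \<in> bcontfun" for n
      using contg[of n] bg[of n] by (auto simp: bcontfun_def bounded_iff)
    have lim: "(\<lambda>n. g n x) \<longlonglongrightarrow> indicator C x" for x
    proof (cases "x \<in> C")
      case True
      then show ?thesis by (simp add: g_def)
    next
      case False
      then have pos: "infdist x C > 0"
        using C infdist_pos_not_in_closed by blast
      obtain m where m: "real m * infdist x C > 1"
        using reals_Archimedean3[OF pos] by blast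
      have "g n x = 0" if "n \<ge> m" for n
      proof -
        have "real m * infdist x C \<le> real n * infdist x C"
          using that pos by (intro mult_right_mono) auto
        then show ?thesis using m by (simp add: g_def)
      qed
      then have "eventually (\<lambda>n. g n x = 0) sequentially"
        using eventually_sequentially by blast
      then show ?thesis using False by (simp add: tendsto_eventually)
    qed
    have conv: "(\<lambda>n. \<integral>x. g n x \<partial>Q) \<longlonglongrightarrow> measure Q C"
      if Q: "finite_measure Q" "sets Q = sets borel" for Q :: "'a measure"
    proof -
      interpret finite_measure Q by fact
      have spQ: "space Q = UNIV" using Q(2) by (auto dest: sets_eq_imp_space_eq)
      have mg: "g n \<in> borel_measurable Q" for n
        using borel_measurable_continuous_onI[OF contg[of n]] measurable_cong_sets[OF Q(2) refl]
        by blast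
      have mC: "C \<in> sets Q" using Q(2) C by auto
      have "(\<lambda>n. \<integral>x. g n x \<partial>Q) \<longlonglongrightarrow> (\<integral>x. indicator C x \<partial>Q)"
        by (rule integral_dominated_convergence[where w = "\<lambda>_. 1"])
          (use mg mC lim bg in auto)
      then show ?thesis using mC spQ by simp
    qed
    show ?thesis
      using LIMSEQ_unique[OF conv[OF fin(1) M(2)]] conv[OF fin(2) N(2)] ints[OF gb] by simp
  qed
  show "M = N"
  proof (rule measure_eqI_generator_eq[where E = "Collect closed" and \<Omega> = UNIV
        and A = "\<lambda>_. UNIV"])
    show "Int_stable (Collect closed :: 'a set set)"
      by (auto simp: Int_stable_def)
    show "emeasure M X = emeasure N X" if "X \<in> Collect closed" for X
      using closed_eq[of X] that fin by (cases "X = {}") (auto simp: finite_measure.emeasure_eq_measure)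
    show "sets M = sigma_sets UNIV (Collect closed)" "sets N = sigma_sets UNIV (Collect closed)"
      unfolding M(2) N(2) by (simp_all add: borel_eq_closed)
    show "emeasure M UNIV \<noteq> \<infinity>" for i :: nat
      using fin(1) sp(1) by (metis finite_measure.emeasure_finite infinity_ennreal_def)
  qed auto
qed

end

theory Submission
  imports Defs
begin

text \<open>
  Write \<open>X\<close> for the compact space of configurations \<open>f2_omega \<Rightarrow> B\<close>. By the Riesz representation theorem
  (\<open>integral_riesz_measure\<close>), affine-exchangeable probability measures on \<open>X\<close> are the same as positive,
  normalised, invariant functionals on \<open>C(X)\<close>, here called invariant states
  (\<open>image_integral_functional\<close>). After this translation measures no longer occur.

  Compactness of the set of states is the Banach-Alaoglu argument (\<open>compactin_invariant_states\<close>). If it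
  is nonempty, it is a simplex, for every family of homeomorphisms: the positive part of a difference of two positive
  invariant functionals, given by the Riesz-Kantorovich formula, is again invariant
  (\<open>exists_positive_part\<close>), and positive parts make the span of the cone a lattice.

  That the extreme points form a closed set is special to the affine group. There are affine maps
  \<open>\<gamma> m\<close> that move every finite set \<open>S\<close>, for large \<open>m\<close>, into general position with respect to itself,
  and any two such general positions are related by an affine map fixing \<open>S\<close>
  (\<open>generic_affine_general_position\<close>). Hence for functions \<open>f\<close>, \<open>g\<close> of the coordinates in \<open>S\<close> and a state
  \<open>\<Lambda>\<close>, the correlation \<open>\<Lambda> (f \<cdot> g \<circ> \<gamma> m)\<close> does not depend on \<open>m\<close> once \<open>m\<close> is large. A state is extreme if and
  only if these correlations factor as \<open>\<Lambda> f \<cdot> \<Lambda> g\<close>, and this is visibly a closed condition.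
  In one direction, \<open>F \<mapsto> lim \<Lambda> (F \<cdot> g \<circ> \<gamma> m)\<close> is an invariant functional below \<open>\<Lambda>\<close>, so it is proportional
  to an extreme \<open>\<Lambda>\<close> (\<open>extreme_imp_product\<close>). In the other direction, the factorisation makes generic translates
  of \<open>f\<close> uncorrelated, so that averages of them have arbitrarily small variance; a state that appears
  in a convex decomposition of \<open>\<Lambda>\<close> then has the same value at \<open>f\<close> as \<open>\<Lambda>\<close>
  (\<open>generically_independent_imp_extreme\<close>).
\<close>

section \<open>Riesz representation on compact metric spaces\<close>

locale positive_functional =
  fixes F :: "('a::topological_space \<Rightarrow> real) \<Rightarrow> real"
  assumes add: "continuous_on UNIV f \<Longrightarrow> continuous_on UNIV g \<Longrightarrow> F (\<lambda>x. f x + g x) = F f + F g"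
    and scale: "continuous_on UNIV f \<Longrightarrow> F (\<lambda>x. c * f x) = c * F f"
    and nonneg: "continuous_on UNIV f \<Longrightarrow> (\<And>x. 0 \<le> f x) \<Longrightarrow> 0 \<le> F f"
begin

lemma const: "F (\<lambda>_. c) = c * F (\<lambda>_. 1)"
  using scale[of "\<lambda>_. 1" c] by simp

lemma diff:
  assumes "continuous_on UNIV f" "continuous_on UNIV g"
  shows "F (\<lambda>x. f x - g x) = F f - F g"
  using add[of f "\<lambda>x. (-1) * g x"] scale[of g "-1"] assms
  by (simp add: continuous_on_minus)

lemma sum:
  assumes "\<And>i. i \<in> I \<Longrightarrow> continuous_on UNIV (f i)"
  shows "F (\<lambda>x. \<Sum>i\<in>I. f i x) = (\<Sum>i\<in>I. F (f i))"
  using assms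
proof (induction I rule: infinite_finite_induct)
  case (insert i I)
  then show ?case
    using add[of "f i" "\<lambda>x. \<Sum>i\<in>I. f i x"] by (simp add: continuous_on_sum)
qed (use const[of 0] in auto)

lemma mono:
  assumes "continuous_on UNIV f" "continuous_on UNIV g" "\<And>x. f x \<le> g x"
  shows "F f \<le> F g"
  using nonneg[of "\<lambda>x. g x - f x"] diff[of g f] assms by (simp add: continuous_on_diff)

lemma bound:
  assumes "continuous_on UNIV f" "\<And>x. \<bar>f x\<bar> \<le> C"
  shows "\<bar>F f\<bar> \<le> C * F (\<lambda>_. 1)"
proof -
  have "- C \<le> f x" "f x \<le> C" for x
    using assms(2)[of x] by auto
  then show ?thesis
    using mono[of f "\<lambda>_. C"] mono[of "\<lambda>_. - C" f] assms(1) const[of C] const[of "- C"]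
    by (simp add: abs_le_iff)
qed

lemma one_nonneg: "0 \<le> F (\<lambda>_. 1)"
  by (rule nonneg) auto

text \<open>
  Dini's argument: by compactness finitely many of the pointwise inequalities cover the space, and
  monotonicity in \<open>k\<close> merges them into one. This is the only source of countable additivity in the
  representation theorem below.
\<close>

lemma le_eventually_increasing:
  assumes cpt: "compact (UNIV :: 'a set)"
    and f: "continuous_on UNIV f" and h: "\<And>k. continuous_on UNIV (h k)"
    and inc: "\<And>k x. h k x \<le> h (Suc k) x" and le: "\<And>x. \<exists>k. f x < h k x + e"
  shows "\<exists>k::nat. F f \<le> F (h k) + e * F (\<lambda>_. 1)"
proof -
  have inc': "h k x \<le> h l x" if "k \<le> l" for k l x
    using that inc by (rule lift_Suc_mono_le[rotated])
  have op: "open {x. f x < h k x + e}" for k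
    by (intro open_Collect_less continuous_intros f h)
  have cover: "UNIV \<subseteq> (\<Union>k. {x. f x < h k x + e})"
    using le by auto
  obtain J where "J \<subseteq> UNIV" and J: "finite J" "UNIV \<subseteq> (\<Union>k\<in>J. {x. f x < h k x + e})"
    by (rule compactE_image[OF cpt op cover])
  have "f x \<le> h (Max J) x + e" for x
  proof -
    obtain k where "k \<in> J" "f x < h k x + e"
      using J(2) by blast
    then show ?thesis
      using inc'[of k "Max J" x] J(1) by auto
  qed
  then have "F f \<le> F (\<lambda>x. h (Max J) x + e)"
    by (intro mono continuous_intros f h) auto
  also have "\<dots> = F (h (Max J)) + e * F (\<lambda>_. 1)"
    using add[of "h (Max J)" "\<lambda>_. e"] const[of e] h by auto
  finally show ?thesis by blast
qed

text \<open>
  The Riesz measure is the outer measure that gives an open set the supremum of \<open>F f\<close> over all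
  continuous \<open>f\<close> between \<open>0\<close> and its indicator. On a compact space this is the same supremum as
  over functions with support inside the open set: subtracting a small constant from \<open>f\<close> moves its
  support there.
\<close>

definition open_content :: "'a set \<Rightarrow> ennreal" where
  "open_content U =
     (SUP f\<in>{f. continuous_on UNIV f \<and> (\<forall>x. 0 \<le> f x \<and> f x \<le> indicator U x)}. ennreal (F f))"

definition outer_content :: "'a set \<Rightarrow> ennreal" where
  "outer_content A = (INF U\<in>{U. open U \<and> A \<subseteq> U}. open_content U)"

lemma open_content_upper:
  assumes "continuous_on UNIV f" "\<And>x. 0 \<le> f x" "\<And>x. f x \<le> indicator U x"
  shows "ennreal (F f) \<le> open_content U"
  unfolding open_content_def using assms by (intro SUP_upper) auto

lemma open_content_least:
  assumes "\<And>f. continuous_on UNIV f \<Longrightarrow> (\<And>x. 0 \<le> f x) \<Longrightarrow> (\<And>x. f x \<le> indicator U x) \<Longrightarrow>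
    ennreal (F f) \<le> c"
  shows "open_content U \<le> c"
  unfolding open_content_def using assms by (intro SUP_least) auto

lemma open_content_mono:
  assumes "U \<subseteq> V" shows "open_content U \<le> open_content V"
proof (rule open_content_least, rule open_content_upper)
  fix f :: "'a \<Rightarrow> real" and x assume "\<And>x. f x \<le> indicator U x"
  moreover have "indicator U x \<le> (indicator V x :: real)"
    using assms by (auto split: split_indicator)
  ultimately show "f x \<le> indicator V x"
    by (meson order_trans)
qed

lemma outer_content_mono: "A \<subseteq> B \<Longrightarrow> outer_content A \<le> outer_content B"
  unfolding outer_content_def by (rule INF_superset_mono) auto

lemma outer_content_open: "open U \<Longrightarrow> outer_content U = open_content U"
  unfolding outer_content_def
  by (intro antisym INF_lower2[of U] INF_greatest open_content_mono) auto

lemma open_content_empty: "open_content {} = 0"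
proof -
  have "open_content {} \<le> 0"
  proof (rule open_content_least)
    fix f :: "'a \<Rightarrow> real" assume "\<And>x. 0 \<le> f x" "\<And>x. f x \<le> indicator {} x"
    then have "f = (\<lambda>_. 0)" by (auto intro: antisym)
    then show "ennreal (F f) \<le> 0" using const[of 0] by simp
  qed
  then show ?thesis by simp
qed

lemma open_content_UNIV: "open_content UNIV = ennreal (F (\<lambda>_. 1))"
  by (intro antisym open_content_upper open_content_least ennreal_leI mono) auto

end

text \<open>
  Continuous functions increasing to the indicator of an open set. The whole space is a separate
  case because \<^const>\<open>infdist\<close> takes the value \<open>0\<close> on the empty set.
\<close>

definition open_approx :: "'a::metric_space set \<Rightarrow> nat \<Rightarrow> 'a \<Rightarrow> real" where
  "open_approx U k x = (if U = UNIV then 1 else min 1 (real k * infdist x (- U)))"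

lemma continuous_open_approx: "continuous_on UNIV (open_approx U k)"
  unfolding open_approx_def by (cases "U = UNIV") (auto intro!: continuous_intros)

lemma open_approx_nonneg: "0 \<le> open_approx U k x"
  unfolding open_approx_def by (auto simp: infdist_nonneg)

lemma open_approx_le_indicator: "open_approx U k x \<le> indicator U x"
  unfolding open_approx_def by (cases "x \<in> U") auto

lemma open_approx_mono: "k \<le> l \<Longrightarrow> open_approx U k x \<le> open_approx U l x"
  using mult_right_mono[of "real k" "real l" "infdist x (- U)"]
  by (auto simp: open_approx_def infdist_nonneg)

lemma open_approx_eq_1:
  assumes "open U" "x \<in> U"
  shows "\<exists>k. \<forall>l\<ge>k. open_approx U l x = 1"
proof (cases "U = UNIV")
  case False
  then have pos: "infdist x (- U) > 0"
    using infdist_pos_not_in_closed[of "- U" x] assms by auto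
  then obtain k where k: "real k * infdist x (- U) > 1"
    using reals_Archimedean3 by blast
  have "open_approx U l x = 1" if "l \<ge> k" for l
  proof -
    have "real k * infdist x (- U) \<le> real l * infdist x (- U)"
      using that pos by (intro mult_right_mono) auto
    then show ?thesis using k False by (simp add: open_approx_def)
  qed
  then show ?thesis by blast
qed (simp add: open_approx_def)

locale positive_functional_compact = positive_functional F
  for F :: "('a::metric_space \<Rightarrow> real) \<Rightarrow> real" +
  assumes cpt: "compact (UNIV :: 'a set)"
begin

text \<open>
  A function below the indicator of the union is, up to \<open>d\<close>, below a finite sum of the functions
  \<^const>\<open>open_approx\<close> of the individual sets, by \<open>le_eventually_increasing\<close>.
\<close>

lemma open_content_Union:
  fixes U :: "nat \<Rightarrow> 'a set"
  assumes U: "\<And>i. open (U i)"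
  shows "open_content (\<Union>i. U i) \<le> (suminf (\<lambda>i. open_content (U i)))"
proof (rule open_content_least)
  fix f :: "'a \<Rightarrow> real"
  assume f: "continuous_on UNIV f" "\<And>x. 0 \<le> f x" "\<And>x. f x \<le> indicator (\<Union>i. U i) x"
  \<comment> \<open>The one index \<open>k\<close> controls both the number of sets and the quality of the approximation, so that
    \<open>h\<close> is increasing in \<open>k\<close>.\<close>
  define h where "h k x = (\<Sum>i<k. open_approx (U i) k x)" for k x
  have conth: "continuous_on UNIV (h k)" for k
    unfolding h_def by (intro continuous_intros continuous_open_approx)
  have inch: "h k x \<le> h (Suc k) x" for k x
  proof -
    have "h k x \<le> (\<Sum>i<k. open_approx (U i) (Suc k) x)"
      unfolding h_def by (intro sum_mono open_approx_mono) auto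
    also have "\<dots> \<le> h (Suc k) x"
      by (simp add: h_def open_approx_nonneg)
    finally show ?thesis .
  qed
  have hge: "\<exists>k. f x \<le> h k x" for x
  proof (cases "x \<in> (\<Union>i. U i)")
    case True
    then obtain i where i: "x \<in> U i" by blast
    obtain k where k: "\<And>l. l \<ge> k \<Longrightarrow> open_approx (U i) l x = 1"
      using open_approx_eq_1[OF U i] by blast
    have "1 = (\<Sum>j\<in>{i}. open_approx (U j) (max k (Suc i)) x)"
      using k[of "max k (Suc i)"] by simp
    also have "\<dots> \<le> h (max k (Suc i)) x"
      unfolding h_def by (rule sum_mono2) (auto simp: open_approx_nonneg)
    finally show ?thesis
      using f(3)[of x] True by (intro exI[of _ "max k (Suc i)"]) auto
  next
    case False
    then show ?thesis using f(3)[of x] by (intro exI[of _ 0]) (simp add: h_def)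
  qed
  show "ennreal (F f) \<le> (suminf (\<lambda>i. open_content (U i)))"
  proof (rule ennreal_le_epsilon)
    fix e :: real assume e: "e > 0"
    \<comment> \<open>The summand \<open>1\<close> in the denominator covers the functional \<open>0\<close>.\<close>
    define d where "d = e / (F (\<lambda>_. 1) + 1)"
    have d: "d > 0" "d * F (\<lambda>_. 1) \<le> e"
      using e one_nonneg by (auto simp: d_def field_simps)
    have "\<exists>k. f x < h k x + d" for x
    proof -
      obtain k where "f x \<le> h k x"
        using hge by blast
      with d(1) have "f x < h k x + d" by simp
      then show ?thesis ..
    qed
    then obtain k where "F f \<le> F (h k) + d * F (\<lambda>_. 1)"
      using le_eventually_increasing[where h = h and f = f and e = d, OF cpt f(1) conth inch] by blast
    moreover have "F (h k) = (\<Sum>i<k. F (open_approx (U i) k))"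
      unfolding h_def by (rule sum) (rule continuous_open_approx)
    ultimately have "F f \<le> (\<Sum>i<k. F (open_approx (U i) k)) + e"
      using d(2) by linarith
    then have "ennreal (F f) \<le> ennreal (\<Sum>i<k. F (open_approx (U i) k)) + ennreal e"
      using e by (subst ennreal_plus[symmetric])
        (auto intro!: ennreal_leI sum_nonneg nonneg continuous_open_approx open_approx_nonneg)
    also have "ennreal (\<Sum>i<k. F (open_approx (U i) k)) = (\<Sum>i<k. ennreal (F (open_approx (U i) k)))"
      by (intro sum_ennreal[symmetric] nonneg continuous_open_approx open_approx_nonneg)
    also have "\<dots> \<le> (\<Sum>i<k. open_content (U i))"
      by (intro sum_mono open_content_upper continuous_open_approx open_approx_nonneg
          open_approx_le_indicator)
    also have "\<dots> \<le> (suminf (\<lambda>i. open_content (U i)))"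
      by (rule sum_le_suminf) auto
    finally show "ennreal (F f) \<le> (suminf (\<lambda>i. open_content (U i))) + ennreal e"
      by (simp add: add_right_mono)
  qed
qed

lemma outer_measure_space_outer_content: "outer_measure_space (Pow UNIV) outer_content"
  unfolding outer_measure_space_def
proof (intro conjI)
  show "positive (Pow UNIV) outer_content"
    by (simp add: positive_def outer_content_open open_content_empty)
  show "increasing (Pow UNIV) outer_content"
    by (simp add: increasing_def outer_content_mono)
  show "countably_subadditive (Pow UNIV) outer_content"
  proof (simp add: countably_subadditive_def, safe)
    fix A :: "nat \<Rightarrow> 'a set"
    show "outer_content (\<Union>i. A i) \<le> (suminf (\<lambda>n. outer_content (A n)))"
    proof (rule ennreal_le_epsilon)
      fix e :: real assume "0 < e" "(suminf (\<lambda>n. outer_content (A n))) < top_class.top"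
      then have *: "outer_content (A n) < outer_content (A n) + e * (1/2)^Suc n" for n
        by (auto simp add: less_top dest!: ennreal_suminf_lessD)
      have "\<exists>U. open U \<and> A n \<subseteq> U \<and> open_content U < outer_content (A n) + e * (1/2)^Suc n" for n
        using *[of n] unfolding outer_content_def[of "A n"] INF_less_iff by auto
      then obtain U where U: "\<And>n. open (U n)" "\<And>n. A n \<subseteq> U n"
          "\<And>n. open_content (U n) < outer_content (A n) + e * (1/2)^Suc n"
        by metis
      have "outer_content (\<Union>i. A i) \<le> outer_content (\<Union>i. U i)"
        using U(2) by (intro outer_content_mono) blast
      also have "\<dots> \<le> (suminf (\<lambda>n. open_content (U n)))"
        using U(1) by (subst outer_content_open) (auto intro!: open_content_Union)
      also have "\<dots> \<le> (suminf (\<lambda>n. outer_content (A n) + e * (1/2) ^ Suc n))"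
        using U(3) by (intro suminf_le allI less_imp_le) auto
      also have "\<dots> = (suminf (\<lambda>n. outer_content (A n))) + (suminf (\<lambda>n. ennreal e * ennreal ((1/2) ^ Suc n)))"
        using \<open>0 < e\<close> by (subst suminf_add[symmetric])
          (auto simp del: ennreal_suminf_cmult simp add: ennreal_mult[symmetric])
      also have "\<dots> = (suminf (\<lambda>n. outer_content (A n))) + e"
        unfolding ennreal_suminf_cmult
        by (subst suminf_ennreal_eq[OF zero_le_power power_half_series]) auto
      finally show "outer_content (\<Union>i. A i) \<le> (suminf (\<lambda>n. outer_content (A n))) + e" .
    qed
  qed
qed

text \<open>
  If \<open>f\<close> nearly attains the content of \<open>W \<inter> U\<close>, then \<open>W - U\<close> lies in the open set where \<open>f < d\<close>. Any
  \<open>h\<close> living there is disjoint from the truncation \<open>max 0 (f - d)\<close>, so their sum competes for the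
  content of \<open>W\<close>.
\<close>

lemma outer_content_split_open:
  assumes U: "open U" and W: "open W"
  shows "open_content (W \<inter> U) + outer_content (W - U) \<le> open_content W"
proof -
  have "ennreal (F f) + outer_content (W - U) \<le> open_content W"
    if f: "continuous_on UNIV f" "\<And>x. 0 \<le> f x" "\<And>x. f x \<le> indicator (W \<inter> U) x" for f
  proof (rule ennreal_le_epsilon)
    fix e :: real assume e: "e > 0"
    define d where "d = e / (F (\<lambda>_. 1) + 1)"
    have d: "d > 0" "d * F (\<lambda>_. 1) \<le> e"
      using e one_nonneg by (auto simp: d_def field_simps)
    define V where "V = W \<inter> {x. f x < d}"
    have V: "open V"
      unfolding V_def by (intro open_Int W open_Collect_less continuous_intros f(1))
    have "f x < d" if "x \<in> W - U" for x
      using f(3)[of x] that d(1) by simp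
    then have "outer_content (W - U) \<le> open_content V"
      using V by (subst outer_content_open[symmetric]) (auto intro!: outer_content_mono simp: V_def)
    then have "ennreal (F f) + outer_content (W - U) \<le> ennreal (F f) + open_content V"
      by (rule add_left_mono)
    also have "\<dots> = (SUP h\<in>{h. continuous_on UNIV h \<and> (\<forall>x. 0 \<le> h x \<and> h x \<le> indicator V x)}.
        ennreal (F f) + ennreal (F h))"
      unfolding open_content_def
      by (rule ennreal_SUP_add_right) (auto intro!: exI[of _ "\<lambda>_. 0"])
    also have "\<dots> \<le> open_content W + ennreal e"
    proof (rule SUP_least, clarify)
      fix h :: "'a \<Rightarrow> real"
      assume h: "continuous_on UNIV h" "\<forall>x. 0 \<le> h x \<and> h x \<le> indicator V x"
      have c: "continuous_on UNIV (\<lambda>x. max 0 (f x - d))"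
        by (intro continuous_intros f)
      have bd: "max 0 (f x - d) + h x \<le> indicator W x" for x
        using f(2,3)[of x] h(2)[rule_format, of x] d(1)
        by (cases "x \<in> V"; cases "x \<in> W"; cases "x \<in> U") (auto simp: V_def)
      have "F f \<le> F (\<lambda>x. max 0 (f x - d) + d)"
        using f(1) by (intro mono continuous_intros) auto
      also have "\<dots> = F (\<lambda>x. max 0 (f x - d)) + d * F (\<lambda>_. 1)"
        using add[OF c, of "\<lambda>_. d"] const[of d] by auto
      finally have "F f + F h \<le> F (\<lambda>x. max 0 (f x - d) + h x) + e"
        using add[OF c h(1)] d(2) by simp
      moreover have "0 \<le> F f" "0 \<le> F h"
        using f h by (auto intro: nonneg)
      moreover have "0 \<le> F (\<lambda>x. max 0 (f x - d) + h x)"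
        using h c by (intro nonneg continuous_intros f h) auto
      ultimately have "ennreal (F f) + ennreal (F h) \<le> ennreal (F (\<lambda>x. max 0 (f x - d) + h x)) + ennreal e"
        using e by (simp add: ennreal_plus[symmetric] del: ennreal_plus)
      also have "ennreal (F (\<lambda>x. max 0 (f x - d) + h x)) \<le> open_content W"
        using h bd by (intro open_content_upper continuous_intros f h) auto
      finally show "ennreal (F f) + ennreal (F h) \<le> open_content W + ennreal e"
        by (simp add: add_right_mono)
    qed
    finally show "ennreal (F f) + outer_content (W - U) \<le> open_content W + ennreal e" .
  qed
  then have "(SUP f\<in>{f. continuous_on UNIV f \<and> (\<forall>x. 0 \<le> f x \<and> f x \<le> indicator (W \<inter> U) x)}.
      ennreal (F f) + outer_content (W - U)) \<le> open_content W"
    by (intro SUP_least) auto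
  moreover have "open_content (W \<inter> U) + outer_content (W - U) =
     (SUP f\<in>{f. continuous_on UNIV f \<and> (\<forall>x. 0 \<le> f x \<and> f x \<le> indicator (W \<inter> U) x)}.
      ennreal (F f) + outer_content (W - U))"
    unfolding open_content_def
    by (rule ennreal_SUP_add_left[symmetric]) (auto intro!: exI[of _ "\<lambda>_. 0"])
  ultimately show ?thesis by simp
qed

lemma open_in_lambda_system:
  assumes U: "open U"
  shows "U \<in> lambda_system UNIV (Pow UNIV) outer_content"
proof -
  note oms = outer_measure_space_outer_content[unfolded outer_measure_space_def]
  have "outer_content (A \<inter> U) + outer_content (A - U) = outer_content A" for A
  proof (rule antisym)
    show "outer_content (A \<inter> U) + outer_content (A - U) \<le> outer_content A"
      unfolding outer_content_def[of A]
    proof (rule INF_greatest, clarify)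
      fix W assume W: "open W" "A \<subseteq> W"
      have "outer_content (A \<inter> U) + outer_content (A - U) \<le>
          outer_content (W \<inter> U) + outer_content (W - U)"
        using W by (intro add_mono outer_content_mono) auto
      also have "\<dots> \<le> open_content W"
        using outer_content_split_open[OF U W(1)] U W(1) by (simp add: outer_content_open open_Int)
      finally show "outer_content (A \<inter> U) + outer_content (A - U) \<le> open_content W" .
    qed
    have "subadditive (Pow UNIV) outer_content"
      using ring_of_sets.countably_subadditive_subadditive[OF ring_of_sets_Pow] oms by metis
    then have "outer_content ((A \<inter> U) \<union> (A - U)) \<le> outer_content (A \<inter> U) + outer_content (A - U)"
      by (rule subadditiveD) auto
    then show "outer_content A \<le> outer_content (A \<inter> U) + outer_content (A - U)"
      by (simp add: Int_Diff_Un)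
  qed
  then show ?thesis
    unfolding algebra.lambda_system_eq[OF algebra_Pow] by simp
qed

definition riesz_measure :: "'a measure" where
  "riesz_measure = measure_of UNIV (sets borel) outer_content"

lemma sets_riesz_measure: "sets riesz_measure = sets borel"
  unfolding riesz_measure_def
  by (metis sets.sigma_sets_eq sets_measure_of space_borel subset_UNIV Pow_UNIV)

lemma emeasure_riesz_measure:
  assumes "A \<in> sets borel" shows "emeasure riesz_measure A = outer_content A"
proof -
  let ?L = "lambda_system UNIV (Pow UNIV) outer_content"
  have ms: "measure_space UNIV ?L outer_content"
    by (rule sigma_algebra.caratheodory_lemma[OF sigma_algebra_Pow outer_measure_space_outer_content])
  then have L: "sigma_algebra UNIV ?L"
    by (simp add: measure_space_def)
  have "sets borel \<subseteq> ?L"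
    using open_in_lambda_system sigma_algebra.sigma_sets_subset[OF L, of "{S. open S}"]
    by (auto simp: borel_def)
  then have "measure_space UNIV (sets borel) outer_content"
    using sets.sigma_algebra_axioms[of borel] by (intro measure_down[OF ms]) auto
  then show ?thesis
    unfolding riesz_measure_def measure_space_def
    using assms by (intro emeasure_measure_of_sigma) auto
qed

lemma emeasure_riesz_measure_open: "open U \<Longrightarrow> emeasure riesz_measure U = open_content U"
  by (simp add: emeasure_riesz_measure outer_content_open)

lemma space_riesz_measure: "space riesz_measure = UNIV"
  using sets_eq_imp_space_eq[OF sets_riesz_measure] by simp

lemma finite_measure_riesz_measure: "finite_measure riesz_measure"
  by standard (simp add: space_riesz_measure emeasure_riesz_measure_open open_content_UNIV)

lemma measure_riesz_measure_UNIV: "measure riesz_measure UNIV = F (\<lambda>_. 1)"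
  by (simp add: measure_def emeasure_riesz_measure_open open_content_UNIV one_nonneg)

lemma borel_measurable_riesz_measure:
  "continuous_on UNIV f \<Longrightarrow> (f :: 'a \<Rightarrow> real) \<in> borel_measurable riesz_measure"
  using borel_measurable_continuous_onI measurable_cong_sets[OF sets_riesz_measure refl] by blast

text \<open>
  Slice the graph of \<open>f\<close> horizontally into \<open>n\<close> layers of height \<open>y = 1 / n\<close>. Each layer lies below \<open>y\<close>
  times the indicator of an open superlevel set \<open>U j\<close>, and these step functions add up to at most
  \<open>f + y\<close>.
\<close>

lemma le_integral_riesz_measure:
  assumes f: "continuous_on UNIV f" "\<And>x. 0 \<le> f x" "\<And>x. f x \<le> 1"
  shows "F f \<le> (\<integral>x. f x \<partial>riesz_measure)"
proof -
  interpret M: finite_measure riesz_measure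
    by (rule finite_measure_riesz_measure)
  have step: "F f \<le> (\<integral>x. f x \<partial>riesz_measure) + F (\<lambda>_. 1) / real n" if n: "n > 0" for n
  proof -
    define y where "y = 1 / real n"
    have y: "y > 0" "real n * y = 1"
      using n by (simp_all add: y_def)
    define s where "s j x = max 0 (min (f x - real j * y) y)" for j x
    define U where "U j = {x. real j * y < f x}" for j
    have conts: "continuous_on UNIV (s j)" for j
      unfolding s_def by (intro continuous_intros f)
    have openU: "open (U j)" for j
      unfolding U_def by (intro open_Collect_less continuous_intros f)
    have "(\<Sum>j<m. s j x) = min (f x) (m * y)" for m x
    proof (induction m)
      case (Suc m)
      have "real (Suc m) * y = m * y + y"
        by (simp add: algebra_simps)
      with Suc y(1) show ?case
        unfolding s_def by auto
    qed (use f(2)[of x] in auto)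
    from this[of _ n] have slices: "f = (\<lambda>x. \<Sum>j<n. s j x)"
      using y f(3) by (auto simp: fun_eq_iff)
    have "F f = (\<Sum>j<n. F (s j))"
      by (subst slices) (rule sum, rule conts)
    also have "\<dots> \<le> (\<Sum>j<n. measure riesz_measure (U j) * y)"
    proof (rule sum_mono)
      fix j
      have "ennreal (F (\<lambda>x. n * s j x)) \<le> open_content (U j)"
      proof (rule open_content_upper)
        fix x
        have "n * s j x \<le> n * y"
          using y(1) by (intro mult_left_mono) (auto simp: s_def)
        then show "n * s j x \<le> indicator (U j) x"
          using y by (cases "x \<in> U j") (auto simp: U_def s_def)
      qed (auto intro!: continuous_intros f(1) simp: s_def)
      also have "\<dots> = ennreal (measure riesz_measure (U j))"
        by (simp add: emeasure_riesz_measure_open[OF openU, symmetric] M.emeasure_eq_measure)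
      finally have "n * F (s j) \<le> measure riesz_measure (U j)"
        using scale[OF conts, of "real n" j] by (simp add: ennreal_le_iff)
      then show "F (s j) \<le> measure riesz_measure (U j) * y"
        using n by (simp add: y_def field_simps)
    qed
    also have "\<dots> = (\<integral>x. (\<Sum>j<n. indicator (U j) x * y) \<partial>riesz_measure)"
      by (subst Bochner_Integration.integral_sum)
        (auto simp: space_riesz_measure sets_riesz_measure openU less_top[symmetric])
    also have "\<dots> \<le> (\<integral>x. f x + y \<partial>riesz_measure)"
    proof (rule integral_mono)
      show "integrable riesz_measure (\<lambda>x. \<Sum>j<n. indicator (U j) x * y)"
        by (intro Bochner_Integration.integrable_sum integrable_mult_left integrable_real_indicator)
          (auto simp: sets_riesz_measure openU less_top[symmetric])
      show "integrable riesz_measure (\<lambda>x. f x + y)"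
        using f by (intro Bochner_Integration.integrable_add M.integrable_const_bound[where B = 1] M.integrable_const
            borel_measurable_riesz_measure) auto
      fix x
      have "(\<Sum>j<m. indicator (U j) x * y) \<le> min (f x + y) (m * y)" for m
      proof (induction m)
        case (Suc m)
        have "real (Suc m) * y = m * y + y"
          by (simp add: algebra_simps)
        with Suc y(1) f(2)[of x] show ?case
          by (cases "x \<in> U m") (auto simp: U_def)
      qed (use f(2)[of x] y(1) in auto)
      from this[of n] show "(\<Sum>j<n. indicator (U j) x * y) \<le> f x + y"
        by simp
    qed
    also have "\<dots> = (\<integral>x. f x \<partial>riesz_measure) + F (\<lambda>_. 1) / n"
      using f by (subst Bochner_Integration.integral_add)
        (auto intro!: M.integrable_const_bound[where B = 1] borel_measurable_riesz_measure
          simp: space_riesz_measure measure_riesz_measure_UNIV y_def)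
    finally show ?thesis .
  qed
  have "(\<lambda>n. (\<integral>x. f x \<partial>riesz_measure) + F (\<lambda>_. 1) / real n) \<longlonglongrightarrow> (\<integral>x. f x \<partial>riesz_measure) + 0"
    by (intro tendsto_intros lim_const_over_n)
  then have "F f \<le> (\<integral>x. f x \<partial>riesz_measure) + 0"
    by (rule LIMSEQ_le_const) (use step in \<open>auto intro!: exI[of _ 1]\<close>)
  then show ?thesis by simp
qed

text \<open>
  The inequality just shown, applied to both \<open>g\<close> and \<open>1 - g\<close>, is an equality because the total mass
  is \<open>F 1\<close>; a general \<open>f\<close> is rescaled to take values in the unit interval.
\<close>

theorem integral_riesz_measure:
  assumes f: "continuous_on UNIV f"
  shows "(\<integral>x. f x \<partial>riesz_measure) = F f"
proof -
  interpret M: finite_measure riesz_measure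
    by (rule finite_measure_riesz_measure)
  have eq: "(\<integral>x. g x \<partial>riesz_measure) = F g"
    if g: "continuous_on UNIV g" "\<And>x. 0 \<le> g x" "\<And>x. g x \<le> 1" for g
  proof -
    have int: "integrable riesz_measure g"
      using g by (intro M.integrable_const_bound[where B = 1] borel_measurable_riesz_measure) auto
    have "F (\<lambda>x. 1 - g x) \<le> (\<integral>x. 1 - g x \<partial>riesz_measure)"
      using g by (intro le_integral_riesz_measure continuous_intros) auto
    also have "\<dots> = F (\<lambda>_. 1) - (\<integral>x. g x \<partial>riesz_measure)"
      using int by (simp add: space_riesz_measure measure_riesz_measure_UNIV)
    finally have "(\<integral>x. g x \<partial>riesz_measure) \<le> F g"
      using diff[of "\<lambda>_. 1" g] g(1) by simp
    with le_integral_riesz_measure[OF g] show ?thesis by simp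
  qed
  have "bounded (range f)"
    using compact_continuous_image[OF f cpt] by (rule compact_imp_bounded)
  then obtain C where C: "C > 0" "\<And>x. \<bar>f x\<bar> \<le> C"
    by (auto simp: bounded_pos)
  define g where "g x = (C + f x) / (2 * C)" for x
  have "0 \<le> C + f x" "C + f x \<le> 2 * C" for x
    using C(2)[of x] by auto
  then have g: "continuous_on UNIV g" "\<And>x. 0 \<le> g x" "\<And>x. g x \<le> 1"
    unfolding g_def using f C(1) by (auto intro!: continuous_intros simp: divide_le_eq_1_pos add_increasing)
  have fg: "f = (\<lambda>x. 2 * C * g x + (- C))"
    using C(1) by (simp add: g_def fun_eq_iff)
  have int: "integrable riesz_measure g"
    using g by (intro M.integrable_const_bound[where B = 1] borel_measurable_riesz_measure) auto
  have "F f = 2 * C * F g + (- C) * F (\<lambda>_. 1)"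
    by (subst fg, subst add) (use g(1) scale[OF g(1)] const[of "- C"] in \<open>auto intro!: continuous_intros\<close>)
  moreover have "(\<integral>x. f x \<partial>riesz_measure) = 2 * C * (\<integral>x. g x \<partial>riesz_measure) + (- C) * F (\<lambda>_. 1)"
    by (subst fg, subst Bochner_Integration.integral_add)
      (use int in \<open>auto simp: space_riesz_measure measure_riesz_measure_UNIV\<close>)
  ultimately show ?thesis
    using eq[OF g] by simp
qed

end

section \<open>The strong operator topology\<close>

lemma locally_convex_strong_operator_topology:
  "locally_convex_topology
     (strong_operator_topology :: ('v::real_normed_vector \<Rightarrow>\<^sub>L real) topology)"
  unfolding locally_convex_topology_def
proof (intro conjI allI impI)
  let ?T = "strong_operator_topology :: ('v \<Rightarrow>\<^sub>L real) topology"
  note ev = strong_operator_topology_continuous_evaluation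
  show "topspace ?T = UNIV"
    by (rule strong_operator_topology_topspace)
  show "Hausdorff_space ?T"
    unfolding Hausdorff_space_def
  proof (intro allI impI, elim conjE)
    fix f g :: "'v \<Rightarrow>\<^sub>L real" assume "f \<noteq> g"
    then obtain x where "blinfun_apply f x \<noteq> blinfun_apply g x"
      using blinfun_eqI by blast
    then obtain U V where UV: "open U" "open V" "blinfun_apply f x \<in> U" "blinfun_apply g x \<in> V" "U \<inter> V = {}"
      by (metis hausdorff)
    have "openin ?T {h. blinfun_apply h x \<in> W}" if "open W" for W
      using openin_continuous_map_preimage[OF ev[of x], of W] that
      by (simp add: strong_operator_topology_topspace)
    with UV show "\<exists>U V. openin ?T U \<and> openin ?T V \<and> f \<in> U \<and> g \<in> V \<and> disjnt U V"
      by (intro exI[of _ "{h. blinfun_apply h x \<in> U}"] exI[of _ "{h. blinfun_apply h x \<in> V}"])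
        (auto simp: disjnt_def)
  qed
  show "continuous_map (prod_topology ?T ?T) ?T (\<lambda>(x, y). x + y)"
    unfolding continuous_on_strong_operator_topo_iff_coordinatewise
  proof
    fix v
    have "continuous_map (prod_topology ?T ?T) euclidean
        (\<lambda>p. blinfun_apply (fst p) v + blinfun_apply (snd p) v)"
      by (intro continuous_map_add continuous_map_compose[OF continuous_map_fst ev, unfolded comp_def]
          continuous_map_compose[OF continuous_map_snd ev, unfolded comp_def])
    then show "continuous_map (prod_topology ?T ?T) euclidean
        (\<lambda>p. blinfun_apply (case p of (x, y) \<Rightarrow> x + y) v)"
      by (simp add: split_def blinfun.add_left)
  qed
  show "continuous_map (prod_topology euclideanreal ?T) ?T (\<lambda>(c, x). c *\<^sub>R x)"
    unfolding continuous_on_strong_operator_topo_iff_coordinatewise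
  proof
    fix v
    have "continuous_map (prod_topology euclideanreal ?T) euclidean
        (\<lambda>p. fst p * blinfun_apply (snd p) v)"
      by (intro continuous_map_real_mult continuous_map_fst
          continuous_map_compose[OF continuous_map_snd ev, unfolded comp_def])
    then show "continuous_map (prod_topology euclideanreal ?T) euclidean
        (\<lambda>p. blinfun_apply (case p of (c, x) \<Rightarrow> c *\<^sub>R x) v)"
      by (simp add: split_def blinfun.scaleR_left)
  qed
  fix U and x :: "'v \<Rightarrow>\<^sub>L real" assume Ux: "openin ?T U \<and> x \<in> U"
  then obtain V where V: "open V" "U = blinfun_apply -` V"
    unfolding strong_operator_topology_def openin_pullback_topology by auto
  have "openin (product_topology (\<lambda>_. euclidean) UNIV) V"
    using V(1) by (simp add: open_fun_def)
  moreover have "blinfun_apply x \<in> V"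
    using Ux V by auto
  ultimately have "\<exists>X. blinfun_apply x \<in> (\<Pi>\<^sub>E i\<in>UNIV. X i) \<and> (\<forall>i. openin euclidean (X i)) \<and>
      finite {i. X i \<noteq> topspace euclidean} \<and> (\<Pi>\<^sub>E i\<in>UNIV. X i) \<subseteq> V"
    by (rule product_topology_open_contains_basis)
  then obtain X where X: "blinfun_apply x \<in> (\<Pi>\<^sub>E i\<in>UNIV. X i)" "\<And>i. open (X i)"
      "finite {i. X i \<noteq> UNIV}" "(\<Pi>\<^sub>E i\<in>UNIV. X i) \<subseteq> V"
    by (metis open_openin topspace_euclidean)
  have "\<exists>e>0. ball (blinfun_apply x i) e \<subseteq> X i" for i
    using X(1) X(2)[of i] open_contains_ball[of "X i"] by (auto simp: PiE_UNIV_domain)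
  then obtain e where e: "\<And>i. e i > 0" "\<And>i. ball (blinfun_apply x i) (e i) \<subseteq> X i"
    by metis
  define W where "W = {h. \<forall>i\<in>{i. X i \<noteq> UNIV}. blinfun_apply h i \<in> ball (blinfun_apply x i) (e i)}"
  have "openin ?T W"
    unfolding W_def
    using strong_operator_topology_basis[OF X(3), where U = "\<lambda>i. ball (blinfun_apply x i) (e i)" and x = "\<lambda>i. i"]
    by auto
  moreover have "convex W"
  proof (rule convexI)
    fix f g and s t :: real
    assume fg: "f \<in> W" "g \<in> W" and st: "0 \<le> s" "0 \<le> t" "s + t = 1"
    have "blinfun_apply (s *\<^sub>R f + t *\<^sub>R g) i \<in> ball (blinfun_apply x i) (e i)" if "X i \<noteq> UNIV" for i
      using convexD[OF convex_ball[of "blinfun_apply x i" "e i"] _ _ st] fg that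
      by (simp add: W_def blinfun.add_left blinfun.scaleR_left)
    then show "s *\<^sub>R f + t *\<^sub>R g \<in> W"
      by (simp add: W_def)
  qed
  moreover have "x \<in> W"
    using e(1) by (simp add: W_def)
  moreover have "W \<subseteq> U"
  proof
    fix h assume "h \<in> W"
    have "blinfun_apply h i \<in> X i" for i
    proof (cases "X i = UNIV")
      case False
      with \<open>h \<in> W\<close> have "blinfun_apply h i \<in> ball (blinfun_apply x i) (e i)"
        by (simp add: W_def)
      then show ?thesis using e(2) by blast
    qed simp
    then show "h \<in> U"
      using X(4) V(2) by (auto simp: PiE_UNIV_domain)
  qed
  ultimately show "\<exists>V. openin ?T V \<and> convex V \<and> x \<in> V \<and> V \<subseteq> U"
    by blast
qed

lemma Hausdorff_strong_operator_topology:
  "Hausdorff_space (strong_operator_topology :: ('v::real_normed_vector \<Rightarrow>\<^sub>L real) topology)"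
  using locally_convex_strong_operator_topology[where 'v = 'v] by (simp add: locally_convex_topology_def)

section \<open>Invariant states\<close>

text \<open>
  Bounded continuous functions form a type of their own, which has no products or compositions with
  maps of the space. All estimates are therefore made for plain functions \<open>'a \<Rightarrow> real\<close> that are
  continuous; these two maps translate. On functions that are not continuous and bounded
  \<^const>\<open>Bcontfun\<close>, and hence \<open>apply_functional\<close>, is unspecified.
\<close>

definition apply_functional ::
  "(('a::topological_space \<Rightarrow>\<^sub>C real) \<Rightarrow>\<^sub>L real) \<Rightarrow> ('a \<Rightarrow> real) \<Rightarrow> real" where
  "apply_functional \<Lambda> f = blinfun_apply \<Lambda> (Bcontfun f)"

definition functional_of ::
  "(('a::topological_space \<Rightarrow> real) \<Rightarrow> real) \<Rightarrow> ('a \<Rightarrow>\<^sub>C real) \<Rightarrow>\<^sub>L real" where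
  "functional_of F = Blinfun (\<lambda>f. F (apply_bcontfun f))"

lemma apply_functional_simps [simp]:
  "apply_functional (\<Lambda> + \<Lambda>') f = apply_functional \<Lambda> f + apply_functional \<Lambda>' f"
  "apply_functional (\<Lambda> - \<Lambda>') f = apply_functional \<Lambda> f - apply_functional \<Lambda>' f"
  "apply_functional (c *\<^sub>R \<Lambda>) f = c * apply_functional \<Lambda> f"
  "apply_functional 0 f = 0"
  by (simp_all add: apply_functional_def blinfun.add_left blinfun.diff_left blinfun.scaleR_left)

lemma continuous_map_apply_functional:
  "continuous_map strong_operator_topology euclideanreal (\<lambda>\<Lambda>. apply_functional \<Lambda> f)"
  unfolding apply_functional_def by (rule strong_operator_topology_continuous_evaluation)

text \<open>
  These are the functionals of the invariant finite measures, respectively of the invariant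
  probability measures (\<open>image_integral_functional\<close>).
\<close>

definition invariant_cone ::
  "('a::metric_space \<Rightarrow> 'a) set \<Rightarrow> (('a \<Rightarrow>\<^sub>C real) \<Rightarrow>\<^sub>L real) set" where
  "invariant_cone T =
     {\<Lambda>. (\<forall>f. continuous_on UNIV f \<longrightarrow> (\<forall>x. 0 \<le> f x) \<longrightarrow> 0 \<le> apply_functional \<Lambda> f) \<and>
         (\<forall>t\<in>T. \<forall>f. continuous_on UNIV f \<longrightarrow>
            apply_functional \<Lambda> (\<lambda>x. f (t x)) = apply_functional \<Lambda> f)}"

definition invariant_states ::
  "('a::metric_space \<Rightarrow> 'a) set \<Rightarrow> (('a \<Rightarrow>\<^sub>C real) \<Rightarrow>\<^sub>L real) set" where
  "invariant_states T = {\<Lambda> \<in> invariant_cone T. apply_functional \<Lambda> (\<lambda>_. 1) = 1}"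

lemma invariant_cone_nonneg:
  "\<Lambda> \<in> invariant_cone T \<Longrightarrow> continuous_on UNIV f \<Longrightarrow> (\<And>x. 0 \<le> f x) \<Longrightarrow> 0 \<le> apply_functional \<Lambda> f"
  and invariant_cone_invariant:
  "\<Lambda> \<in> invariant_cone T \<Longrightarrow> t \<in> T \<Longrightarrow> continuous_on UNIV f \<Longrightarrow>
     apply_functional \<Lambda> (\<lambda>x. f (t x)) = apply_functional \<Lambda> f"
  by (simp_all add: invariant_cone_def)

lemma invariant_statesD:
  assumes "\<Lambda> \<in> invariant_states T"
  shows "\<Lambda> \<in> invariant_cone T" "apply_functional \<Lambda> (\<lambda>_. 1) = 1"
  using assms by (simp_all add: invariant_states_def)

lemma invariant_cone_add: "\<Lambda> \<in> invariant_cone T \<Longrightarrow> \<Lambda>' \<in> invariant_cone T \<Longrightarrow> \<Lambda> + \<Lambda>' \<in> invariant_cone T"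
  and invariant_cone_scale: "\<Lambda> \<in> invariant_cone T \<Longrightarrow> 0 \<le> c \<Longrightarrow> c *\<^sub>R \<Lambda> \<in> invariant_cone T"
  and invariant_cone_zero: "0 \<in> invariant_cone T"
  by (simp_all add: invariant_cone_def)

lemma convex_invariant_states: "convex (invariant_states T)"
  by (rule convexI) (simp add: invariant_states_def invariant_cone_add invariant_cone_scale)

locale compact_dynamics =
  fixes T :: "('a::metric_space \<Rightarrow> 'a) set"
  assumes cpt: "compact (UNIV :: 'a set)"
    and continuous: "t \<in> T \<Longrightarrow> continuous_on UNIV t"
    and bij: "t \<in> T \<Longrightarrow> bij t"
    and continuous_inv: "t \<in> T \<Longrightarrow> continuous_on UNIV (inv t)"
begin

lemma bcontfun_iff: "f \<in> bcontfun \<longleftrightarrow> continuous_on UNIV (f :: 'a \<Rightarrow> real)"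
  unfolding bcontfun_def
  using compact_imp_bounded[OF compact_continuous_image[OF _ cpt]] by auto

lemma apply_Bcontfun: "continuous_on UNIV (f :: 'a \<Rightarrow> real) \<Longrightarrow> apply_bcontfun (Bcontfun f) = f"
  by (simp add: bcontfun_iff Bcontfun_inverse)

lemma apply_functional_add:
  fixes f g :: "'a \<Rightarrow> real"
  assumes "continuous_on UNIV f" "continuous_on UNIV g"
  shows "apply_functional \<Lambda> (\<lambda>x. f x + g x) = apply_functional \<Lambda> f + apply_functional \<Lambda> g"
proof -
  have "Bcontfun (\<lambda>x. f x + g x) = Bcontfun f + Bcontfun g"
    using assms by (intro bcontfun_eqI) (simp add: apply_Bcontfun plus_bcontfun.rep_eq continuous_on_add)
  then show ?thesis
    by (simp add: apply_functional_def blinfun.add_right)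
qed

lemma apply_functional_scale:
  fixes f :: "'a \<Rightarrow> real"
  assumes "continuous_on UNIV f"
  shows "apply_functional \<Lambda> (\<lambda>x. c * f x) = c * apply_functional \<Lambda> f"
proof -
  have "Bcontfun (\<lambda>x. c * f x) = c *\<^sub>R Bcontfun f"
    using assms by (intro bcontfun_eqI) (simp add: apply_Bcontfun scaleR_bcontfun.rep_eq continuous_on_mult_left)
  then show ?thesis
    by (simp add: apply_functional_def blinfun.scaleR_right)
qed

lemma functional_eqI:
  fixes \<Lambda> \<Lambda>' :: "('a \<Rightarrow>\<^sub>C real) \<Rightarrow>\<^sub>L real"
  assumes "\<And>f. continuous_on UNIV f \<Longrightarrow> apply_functional \<Lambda> f = apply_functional \<Lambda>' f"
  shows "\<Lambda> = \<Lambda>'"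
proof (rule blinfun_eqI)
  fix f show "blinfun_apply \<Lambda> f = blinfun_apply \<Lambda>' f"
    using assms[of "apply_bcontfun f"] by (simp add: apply_functional_def apply_bcontfun_inverse)
qed

lemma apply_functional_of:
  fixes F :: "('a \<Rightarrow> real) \<Rightarrow> real"
  assumes "positive_functional F" "continuous_on UNIV f"
  shows "apply_functional (functional_of F) f = F f"
proof -
  interpret F: positive_functional F by fact
  have "bounded_linear (\<lambda>f. F (apply_bcontfun f))"
  proof (rule bounded_linear_intro[where K = "F (\<lambda>_. 1)"])
    fix f g :: "'a \<Rightarrow>\<^sub>C real" and c :: real
    show "F (apply_bcontfun (f + g)) = F (apply_bcontfun f) + F (apply_bcontfun g)"
      using F.add[of "apply_bcontfun f" "apply_bcontfun g"]
      by (simp add: plus_bcontfun.rep_eq)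
    show "F (apply_bcontfun (c *\<^sub>R f)) = c *\<^sub>R F (apply_bcontfun f)"
      using F.scale[of "apply_bcontfun f" c] by (simp add: scaleR_bcontfun.rep_eq)
    show "norm (F (apply_bcontfun f)) \<le> norm f * F (\<lambda>_. 1)"
      using F.bound[of "apply_bcontfun f" "norm f"] norm_bounded[of f] by simp
  qed
  then show ?thesis
    by (simp add: apply_functional_def functional_of_def bounded_linear_Blinfun_apply
        apply_Bcontfun assms(2))
qed

lemma positive_functional_apply_functional:
  assumes "\<Lambda> \<in> invariant_cone T"
  shows "positive_functional (apply_functional \<Lambda>)"
  using assms by unfold_locales
    (auto simp: apply_functional_add apply_functional_scale invariant_cone_nonneg)

lemma continuous_on_compose_dynamics:
  "t \<in> T \<Longrightarrow> continuous_on UNIV f \<Longrightarrow> continuous_on UNIV (\<lambda>x. f (t x))"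
  using continuous by (auto intro: continuous_on_compose2)

lemma functional_of_in_invariant_cone:
  assumes "positive_functional F"
    and "\<And>t f. t \<in> T \<Longrightarrow> continuous_on UNIV f \<Longrightarrow> F (\<lambda>x. f (t x)) = F f"
  shows "functional_of F \<in> invariant_cone T"
  using assms positive_functional.nonneg[OF assms(1)]
  by (auto simp: invariant_cone_def apply_functional_of continuous_on_compose_dynamics)

lemma invariant_cone_eq_0:
  assumes L: "\<Lambda> \<in> invariant_cone T" and 0: "apply_functional \<Lambda> (\<lambda>_. 1) = 0"
  shows "\<Lambda> = 0"
proof (rule functional_eqI)
  fix f :: "'a \<Rightarrow> real" assume f: "continuous_on UNIV f"
  interpret F: positive_functional "apply_functional \<Lambda>"
    by (rule positive_functional_apply_functional[OF L])
  have "\<bar>apply_functional \<Lambda> f\<bar> \<le> norm (Bcontfun f) * 0"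
    unfolding 0[symmetric]
    using f norm_bounded[of "Bcontfun f"] by (intro F.bound) (simp_all add: apply_Bcontfun)
  then show "apply_functional \<Lambda> f = apply_functional 0 f"
    by simp
qed

text \<open>
  The representing measure of an invariant state is invariant because a probability measure is
  determined by its functional.
\<close>

lemma image_integral_functional:
  "integral_functional ` {\<mu>. prob_space \<mu> \<and> sets \<mu> = sets borel \<and> (\<forall>t\<in>T. distr \<mu> borel t = \<mu>)} =
     invariant_states T"
proof (intro equalityI subsetI)
  have ap: "apply_functional (integral_functional \<mu>) f = (\<integral>x. f x \<partial>\<mu>)"
    if "prob_space \<mu>" "sets \<mu> = sets borel" "continuous_on UNIV f" for \<mu> and f :: "'a \<Rightarrow> real"
    using integral_functional_apply[OF prob_space.finite_measure[OF that(1)] that(2), of "Bcontfun f"] that(3)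
    by (simp add: apply_functional_def apply_Bcontfun)
  have meas: "t \<in> measurable \<mu> borel" if "t \<in> T" "sets \<mu> = sets borel" for t \<mu>
    using borel_measurable_continuous_onI[OF continuous[OF that(1)]] measurable_cong_sets[OF that(2) refl]
    by blast
  fix \<Lambda>
  {
    assume "\<Lambda> \<in> integral_functional `
      {\<mu>. prob_space \<mu> \<and> sets \<mu> = sets borel \<and> (\<forall>t\<in>T. distr \<mu> borel t = \<mu>)}"
    then obtain \<mu> where \<mu>: "\<Lambda> = integral_functional \<mu>" "prob_space \<mu>" "sets \<mu> = sets borel"
        "\<And>t. t \<in> T \<Longrightarrow> distr \<mu> borel t = \<mu>"
      by auto
    note ap = ap[OF \<mu>(2,3)]
    have "(\<integral>x. f (t x) \<partial>\<mu>) = (\<integral>x. f x \<partial>\<mu>)"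
      if "t \<in> T" "continuous_on UNIV f" for t and f :: "'a \<Rightarrow> real"
      using integral_distr[OF meas[OF that(1) \<mu>(3)] borel_measurable_continuous_onI[OF that(2)]] \<mu>(4)[OF that(1)]
      by simp
    moreover have "(\<integral>x. 1 \<partial>\<mu>) = (1 :: real)"
      using prob_space.prob_space[OF \<mu>(2)] by simp
    ultimately show "\<Lambda> \<in> invariant_states T"
      unfolding \<mu>(1) by (simp add: invariant_states_def invariant_cone_def ap continuous_on_compose_dynamics)
  next
    assume L: "\<Lambda> \<in> invariant_states T"
    interpret F: positive_functional_compact "apply_functional \<Lambda>"
      by (intro positive_functional_compact.intro positive_functional_compact_axioms.intro
          positive_functional_apply_functional invariant_statesD(1)[OF L] cpt)
    define \<mu> where "\<mu> = F.riesz_measure"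
    have \<mu>: "sets \<mu> = sets borel" "space \<mu> = UNIV"
        "\<And>f. continuous_on UNIV f \<Longrightarrow> (\<integral>x. f x \<partial>\<mu>) = apply_functional \<Lambda> f"
      by (simp_all add: \<mu>_def F.sets_riesz_measure F.space_riesz_measure F.integral_riesz_measure)
    have p: "prob_space \<mu>"
      using F.finite_measure_riesz_measure F.measure_riesz_measure_UNIV invariant_statesD(2)[OF L]
      by (intro prob_spaceI) (simp add: F.space_riesz_measure finite_measure.emeasure_eq_measure \<mu>_def)
    have "distr \<mu> borel t = \<mu>" if t: "t \<in> T" for t
    proof (rule inj_onD[OF inj_on_integral_functional])
      have pd: "prob_space (distr \<mu> borel t)"
        by (rule prob_space.prob_space_distr[OF p meas[OF t \<mu>(1)]])
      show "integral_functional (distr \<mu> borel t) = integral_functional \<mu>"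
      proof (rule functional_eqI)
        fix f :: "'a \<Rightarrow> real" assume f: "continuous_on UNIV f"
        have "continuous_on UNIV (\<lambda>x. f (t x))"
          using t f by (rule continuous_on_compose_dynamics)
        then show "apply_functional (integral_functional (distr \<mu> borel t)) f =
            apply_functional (integral_functional \<mu>) f"
          using f integral_distr[OF meas[OF t \<mu>(1)] borel_measurable_continuous_onI[OF f]]
            invariant_cone_invariant[OF invariant_statesD(1)[OF L] t f]
          by (simp add: ap[OF pd] ap[OF p \<mu>(1)] \<mu>(3))
      qed
    qed (use p \<mu>(1) prob_space.prob_space_distr[OF p meas[OF t \<mu>(1)]] in auto)
    moreover have "\<Lambda> = integral_functional \<mu>"
      by (rule functional_eqI) (simp add: ap[OF p \<mu>(1)] \<mu>(3))
    ultimately show "\<Lambda> \<in> integral_functional `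
      {\<mu>. prob_space \<mu> \<and> sets \<mu> = sets borel \<and> (\<forall>t\<in>T. distr \<mu> borel t = \<mu>)}"
      using p \<mu>(1) by blast
  }
qed

text \<open>
  The Banach-Alaoglu argument: as functions on \<open>C(X)\<close>, the states form a closed subset \<open>Q\<close> of a
  product of compact intervals, and on \<open>Q\<close> the strong operator topology is the product topology.
\<close>

lemma compactin_invariant_states: "compactin vague_topology (invariant_states T)"
proof -
  define Q where "Q = {G :: ('a \<Rightarrow>\<^sub>C real) \<Rightarrow> real.
      (\<forall>f g. G (f + g) = G f + G g) \<and> (\<forall>c f. G (c *\<^sub>R f) = c * G f) \<and>
      (\<forall>f. \<bar>G f\<bar> \<le> norm f) \<and>
      (\<forall>f. (\<forall>x. 0 \<le> apply_bcontfun f x) \<longrightarrow> 0 \<le> G f) \<and>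
      (\<forall>t f. t \<in> T \<longrightarrow> G (Bcontfun (\<lambda>x. apply_bcontfun f (t x))) = G f) \<and>
      G (Bcontfun (\<lambda>_. 1)) = 1}"
  have "closed Q"
    unfolding Q_def
    by (intro closed_Collect_conj closed_Collect_all closed_Collect_imp
        closed_Collect_eq closed_Collect_le open_Collect_const continuous_intros continuous_on_product_coordinates)
  moreover have "compact (\<Pi>\<^sub>E f\<in>UNIV. {- norm f .. norm f} :: (('a \<Rightarrow>\<^sub>C real) \<Rightarrow> real) set)"
    using compactin_PiE[of "\<lambda>_. euclideanreal" "UNIV :: ('a \<Rightarrow>\<^sub>C real) set" "\<lambda>f. {- norm f .. norm f}"]
    by (simp add: euclidean_product_topology)
  moreover have "Q \<subseteq> (\<Pi>\<^sub>E f\<in>UNIV. {- norm f .. norm f})"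
    by (auto simp: Q_def PiE_UNIV_domain abs_le_iff) (metis minus_le_iff)
  ultimately have "compact Q"
    by (metis compact_Int_closed inf.absorb2)
  have blf: "blinfun_apply (Blinfun G) = G" if "G \<in> Q" for G
    using that unfolding Q_def
    by (intro bounded_linear_Blinfun_apply bounded_linear_intro[where K = 1]) auto
  have "continuous_map (top_of_set Q) vague_topology Blinfun"
    unfolding continuous_on_strong_operator_topo_iff_coordinatewise
  proof
    fix f
    have "continuous_on Q (\<lambda>G. G f)"
      by (rule continuous_on_subset[OF continuous_on_product_coordinates]) simp
    then show "continuous_map (top_of_set Q) euclideanreal (\<lambda>G. blinfun_apply (Blinfun G) f)"
      by (subst continuous_map_eq[where f = "\<lambda>G. G f"]) (auto simp: blf)
  qed
  then have "compactin vague_topology (Blinfun ` Q)"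
    using \<open>compact Q\<close> by (intro image_compactin[of "top_of_set Q"]) (auto simp: compactin_subtopology)
  moreover have "Blinfun ` Q = invariant_states T"
  proof (intro equalityI subsetI)
    fix \<Lambda> assume "\<Lambda> \<in> Blinfun ` Q"
    then obtain G where G: "G \<in> Q" "\<Lambda> = Blinfun G" by blast
    have ap: "apply_functional \<Lambda> f = G (Bcontfun f)" for f
      by (simp add: apply_functional_def G(2) blf[OF G(1)])
    have "apply_functional \<Lambda> (\<lambda>x. f (t x)) = apply_functional \<Lambda> f"
      if "t \<in> T" "continuous_on UNIV f" for t f
    proof -
      have "G (Bcontfun (\<lambda>x. apply_bcontfun (Bcontfun f) (t x))) = G (Bcontfun f)"
        using G(1) that(1) unfolding Q_def by blast
      then show ?thesis
        using that(2) by (simp add: ap apply_Bcontfun)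
    qed
    moreover have "0 \<le> apply_functional \<Lambda> f"
      if "continuous_on UNIV f" "\<forall>x. 0 \<le> f x" for f
    proof -
      have "(\<forall>x. 0 \<le> apply_bcontfun (Bcontfun f) x) \<longrightarrow> 0 \<le> G (Bcontfun f)"
        using G(1) unfolding Q_def by blast
      then show ?thesis
        using that by (simp add: ap apply_Bcontfun)
    qed
    moreover have "apply_functional \<Lambda> (\<lambda>_. 1) = 1"
      using G(1) by (simp add: ap Q_def)
    ultimately show "\<Lambda> \<in> invariant_states T"
      by (simp add: invariant_states_def invariant_cone_def)
  next
    fix \<Lambda> assume L: "\<Lambda> \<in> invariant_states T"
    interpret F: positive_functional "apply_functional \<Lambda>"
      by (rule positive_functional_apply_functional[OF invariant_statesD(1)[OF L]])
    have ap: "apply_functional \<Lambda> (apply_bcontfun f) = blinfun_apply \<Lambda> f" for f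
      by (simp add: apply_functional_def apply_bcontfun_inverse)
    have "\<bar>blinfun_apply \<Lambda> f\<bar> \<le> norm f" for f
      using F.bound[of "apply_bcontfun f" "norm f"] norm_bounded[of f] invariant_statesD(2)[OF L]
      by (simp add: ap)
    moreover have "0 \<le> blinfun_apply \<Lambda> f" if "\<forall>x. 0 \<le> apply_bcontfun f x" for f
      using F.nonneg[of "apply_bcontfun f"] that by (simp add: ap)
    moreover have "blinfun_apply \<Lambda> (Bcontfun (\<lambda>x. apply_bcontfun f (t x))) = blinfun_apply \<Lambda> f"
      if "t \<in> T" for t f
      using invariant_cone_invariant[OF invariant_statesD(1)[OF L] that, of "apply_bcontfun f"]
      by (simp add: ap) (simp add: apply_functional_def)
    moreover have "blinfun_apply \<Lambda> (Bcontfun (\<lambda>_. 1)) = 1"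
      using invariant_statesD(2)[OF L] by (simp add: apply_functional_def)
    ultimately have "blinfun_apply \<Lambda> \<in> Q"
      by (simp add: Q_def blinfun.add_right blinfun.scaleR_right)
    then show "\<Lambda> \<in> Blinfun ` Q"
      by (metis blinfun_apply_inverse imageI)
  qed
  ultimately show ?thesis by simp
qed

end

section \<open>Invariant states form a simplex\<close>

text \<open>
  In an ordered group, positive parts give all binary suprema and infima:
  \<open>sup x y = x + (y - x)\<^sup>+\<close> and \<open>inf x y = x - (x - y)\<^sup>+\<close>.
\<close>

lemma lattice_of_positive_parts:
  fixes P :: "'v::ab_group_add set"
  assumes zero: "0 \<in> P" and add: "\<And>x y. x \<in> P \<Longrightarrow> y \<in> P \<Longrightarrow> x + y \<in> P"
    and pointed: "\<And>x. x \<in> P \<Longrightarrow> - x \<in> P \<Longrightarrow> x = 0"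
    and pos_part: "\<And>x y. x \<in> P \<Longrightarrow> y \<in> P \<Longrightarrow>
      \<exists>s\<in>P. s - (x - y) \<in> P \<and> (\<forall>u\<in>P. u - (x - y) \<in> P \<longrightarrow> u - s \<in> P)"
  shows "Lattice.lattice
       \<lparr>carrier = {x - y | x y. x \<in> P \<and> y \<in> P}, eq = (=), le = (\<lambda>x y. y - x \<in> P)\<rparr>"
    (is "Lattice.lattice ?L")
proof -
  define V where "V = {x - y | x y. x \<in> P \<and> y \<in> P}"
  have V_diff: "x - y \<in> V" if "x \<in> V" "y \<in> V" for x y
  proof -
    obtain a b c d where "x = a - b" "y = c - d" "a \<in> P" "b \<in> P" "c \<in> P" "d \<in> P"
      using \<open>x \<in> V\<close> \<open>y \<in> V\<close> unfolding V_def by blast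
    then have "x - y = (a + d) - (b + c)" "a + d \<in> P" "b + c \<in> P"
      by (auto simp: add)
    then show ?thesis unfolding V_def by blast
  qed
  have P_V: "x \<in> V" if "x \<in> P" for x
  proof -
    have "x = x - 0" by simp
    with that zero show ?thesis unfolding V_def by blast
  qed
  have V_add: "x + y \<in> V" if "x \<in> V" "y \<in> V" for x y
    using V_diff[OF that(1) V_diff[OF P_V[OF zero] that(2)]] by simp
  have part: "\<exists>s\<in>P. s - z \<in> P \<and> (\<forall>u\<in>P. u - z \<in> P \<longrightarrow> u - s \<in> P)" if "z \<in> V" for z
    using that pos_part unfolding V_def by blast
  have trans: "z - x \<in> P" if "y - x \<in> P" "z - y \<in> P" for x y z
    using add[OF that] by simp
  have anti: "x = y" if "y - x \<in> P" "x - y \<in> P" for x y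
    using pointed[OF that(1)] that(2) by simp
  have "partial_order ?L"
    by (unfold_locales, simp_all add: zero) (use anti trans in blast)+
  moreover have "\<exists>s. least ?L s (Upper ?L {x, y})" if xy: "x \<in> V" "y \<in> V" for x y
  proof -
    obtain s where s: "s \<in> P" "s - (y - x) \<in> P" "\<And>u. u \<in> P \<Longrightarrow> u - (y - x) \<in> P \<Longrightarrow> u - s \<in> P"
      using part[OF V_diff[OF xy(2,1)]] by blast
    have "least ?L (x + s) (Upper ?L {x, y})"
      unfolding least_def
    proof (intro conjI ballI)
      show "Upper ?L {x, y} \<subseteq> carrier ?L" by (simp add: Upper_def)
      have "x + s \<in> V" "x + s - x \<in> P" "x + s - y \<in> P"
        using xy s V_add P_V by (auto simp: algebra_simps)
      then show "x + s \<in> Upper ?L {x, y}"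
        by (auto simp: Upper_def V_def[symmetric])
      fix z assume "z \<in> Upper ?L {x, y}"
      then have "z - x \<in> P" "z - y \<in> P"
        using xy by (auto simp: Upper_def V_def[symmetric])
      then show "le ?L (x + s) z"
        using s(3)[of "z - x"] by (simp add: algebra_simps)
    qed
    then show ?thesis ..
  qed
  moreover have "\<exists>s. greatest ?L s (Lower ?L {x, y})" if xy: "x \<in> V" "y \<in> V" for x y
  proof -
    obtain s where s: "s \<in> P" "s - (x - y) \<in> P" "\<And>u. u \<in> P \<Longrightarrow> u - (x - y) \<in> P \<Longrightarrow> u - s \<in> P"
      using part[OF V_diff[OF xy]] by blast
    have "greatest ?L (x - s) (Lower ?L {x, y})"
      unfolding greatest_def
    proof (intro conjI ballI)
      show "Lower ?L {x, y} \<subseteq> carrier ?L" by (simp add: Lower_def)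
      have "x - s \<in> V" "x - (x - s) \<in> P" "y - (x - s) \<in> P"
        using xy s V_diff P_V by (auto simp: algebra_simps)
      then show "x - s \<in> Lower ?L {x, y}"
        by (auto simp: Lower_def V_def[symmetric])
      fix z assume "z \<in> Lower ?L {x, y}"
      then have "x - z \<in> P" "y - z \<in> P"
        using xy by (auto simp: Lower_def V_def[symmetric])
      then show "le ?L z (x - s)"
        using s(3)[of "x - z"] by (simp add: algebra_simps)
    qed
    then show ?thesis ..
  qed
  ultimately show ?thesis
    by (intro lattice.intro upper_semilattice.intro lower_semilattice.intro
        upper_semilattice_axioms.intro lower_semilattice_axioms.intro) (simp_all add: V_def)
qed

text \<open>
  The extension is \<open>F f = S f\<^sup>+ - S f\<^sup>-\<close>. Linearity follows from the fact that \<open>S a - S b\<close> depends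
  only on \<open>a - b\<close>.
\<close>

lemma positive_functional_extension:
  fixes S :: "('a::topological_space \<Rightarrow> real) \<Rightarrow> real"
  assumes add: "\<And>f g. continuous_on UNIV f \<Longrightarrow> continuous_on UNIV g \<Longrightarrow> (\<And>x. 0 \<le> f x) \<Longrightarrow>
      (\<And>x. 0 \<le> g x) \<Longrightarrow> S (\<lambda>x. f x + g x) = S f + S g"
    and scale: "\<And>f c. continuous_on UNIV f \<Longrightarrow> (\<And>x. 0 \<le> f x) \<Longrightarrow> 0 \<le> c \<Longrightarrow>
      S (\<lambda>x. c * f x) = c * S f"
    and nonneg: "\<And>f. continuous_on UNIV f \<Longrightarrow> (\<And>x. 0 \<le> f x) \<Longrightarrow> 0 \<le> S f"
  shows "\<exists>F. positive_functional F \<and> (\<forall>f. continuous_on UNIV f \<longrightarrow> (\<forall>x. 0 \<le> f x) \<longrightarrow> F f = S f)"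
proof -
  define F where "F f = S (\<lambda>x. max 0 (f x)) - S (\<lambda>x. max 0 (- f x))" for f
  have F_diff: "F (\<lambda>x. a x - b x) = S a - S b"
    if "continuous_on UNIV a" "continuous_on UNIV b" "\<And>x. 0 \<le> a x" "\<And>x. 0 \<le> b x" for a b
  proof -
    have "S (\<lambda>x. max 0 (a x - b x)) + S b = S (\<lambda>x. max 0 (a x - b x) + b x)"
      using that by (intro add[symmetric] continuous_intros) auto
    also have "(\<lambda>x. max 0 (a x - b x) + b x) = (\<lambda>x. a x + max 0 (- (a x - b x)))"
      by auto
    also have "S \<dots> = S a + S (\<lambda>x. max 0 (- (a x - b x)))"
      using that by (intro add continuous_intros) auto
    finally show ?thesis by (simp add: F_def)
  qed
  have zero: "S (\<lambda>_. 0) = 0"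
    using add[of "\<lambda>_. 0" "\<lambda>_. 0"] by simp
  have F_S: "F f = S f" if "continuous_on UNIV f" "\<And>x. 0 \<le> f x" for f
    using F_diff[of f "\<lambda>_. 0"] that zero by simp
  have "positive_functional F"
  proof
    fix f g :: "'a \<Rightarrow> real" assume fg: "continuous_on UNIV f" "continuous_on UNIV g"
    have "(\<lambda>x. f x + g x) = (\<lambda>x. (max 0 (f x) + max 0 (g x)) - (max 0 (- f x) + max 0 (- g x)))"
      by (auto simp: max_def)
    then have "F (\<lambda>x. f x + g x) =
        S (\<lambda>x. max 0 (f x) + max 0 (g x)) - S (\<lambda>x. max 0 (- f x) + max 0 (- g x))"
      using fg by (simp only:) (intro F_diff continuous_intros; simp)
    also have "\<dots> = F f + F g"
      using fg by (subst (1 2) add) (auto intro!: continuous_intros simp: F_def)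
    finally show "F (\<lambda>x. f x + g x) = F f + F g" .
  next
    fix f :: "'a \<Rightarrow> real" and c :: real assume f: "continuous_on UNIV f"
    show "F (\<lambda>x. c * f x) = c * F f"
    proof (cases "c \<ge> 0")
      case True
      have "(\<lambda>x. c * f x) = (\<lambda>x. c * max 0 (f x) - c * max 0 (- f x))"
        by (auto simp: max_def)
      then have "F (\<lambda>x. c * f x) = S (\<lambda>x. c * max 0 (f x)) - S (\<lambda>x. c * max 0 (- f x))"
        using f True by (simp only:) (intro F_diff continuous_intros; simp)
      also have "\<dots> = c * F f"
        using f True by (subst (1 2) scale) (auto intro!: continuous_intros simp: F_def right_diff_distrib)
      finally show ?thesis .
    next
      case False
      have "(\<lambda>x. c * f x) = (\<lambda>x. (- c) * max 0 (- f x) - (- c) * max 0 (f x))"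
        by (auto simp: max_def)
      then have "F (\<lambda>x. c * f x) = S (\<lambda>x. (- c) * max 0 (- f x)) - S (\<lambda>x. (- c) * max 0 (f x))"
        using f False by (simp only:) (intro F_diff continuous_intros; simp add: mult_nonpos_nonneg)
      also have "\<dots> = c * F f"
        using f False by (subst (1 2) scale) (auto intro!: continuous_intros simp: F_def right_diff_distrib)
      finally show ?thesis .
    qed
  qed (simp add: F_S nonneg)
  with F_S show ?thesis by blast
qed

context compact_dynamics
begin

text \<open>
  The second coordinate in Choquet's cone is the total mass, hence determined by the first.
\<close>

lemma simplex_cone_invariant_states:
  assumes "invariant_states T \<noteq> {}"
  shows "simplex_cone (invariant_states T) =
    (\<lambda>\<Lambda>. (\<Lambda>, apply_functional \<Lambda> (\<lambda>_. 1))) ` invariant_cone T"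
proof (intro equalityI subsetI)
  fix p assume "p \<in> simplex_cone (invariant_states T)"
  then obtain c \<Lambda> where "0 \<le> c" "\<Lambda> \<in> invariant_states T" "p = (c *\<^sub>R \<Lambda>, c)"
    by (auto simp: simplex_cone_def cone_hull_expl)
  then show "p \<in> (\<lambda>\<Lambda>. (\<Lambda>, apply_functional \<Lambda> (\<lambda>_. 1))) ` invariant_cone T"
    by (intro image_eqI[of _ _ "c *\<^sub>R \<Lambda>"])
      (simp_all add: invariant_statesD invariant_cone_scale)
next
  fix p assume "p \<in> (\<lambda>\<Lambda>. (\<Lambda>, apply_functional \<Lambda> (\<lambda>_. 1))) ` invariant_cone T"
  then obtain \<Lambda> where L: "\<Lambda> \<in> invariant_cone T" "p = (\<Lambda>, apply_functional \<Lambda> (\<lambda>_. 1))"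
    by blast
  define c where "c = apply_functional \<Lambda> (\<lambda>_. 1)"
  have c: "c \<ge> 0"
    unfolding c_def by (intro invariant_cone_nonneg[OF L(1)]) auto
  have "\<exists>\<Lambda>'\<in>invariant_states T. \<Lambda> = c *\<^sub>R \<Lambda>'"
  proof (cases "c = 0")
    case True
    then show ?thesis
      using assms invariant_cone_eq_0[OF L(1)] by (auto simp: c_def)
  next
    case False
    then show ?thesis
      using c L(1) by (intro bexI[of _ "(1 / c) *\<^sub>R \<Lambda>"])
        (auto simp: invariant_states_def invariant_cone_scale c_def[symmetric])
  qed
  then obtain \<Lambda>' where "\<Lambda>' \<in> invariant_states T" "\<Lambda> = c *\<^sub>R \<Lambda>'" by blast
  then show "p \<in> simplex_cone (invariant_states T)"
    using c L(2) unfolding c_def[symmetric] simplex_cone_def cone_hull_expl by force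
qed

text \<open>
  The Riesz-Kantorovich formula: the positive part of \<open>\<theta> = \<Phi> - \<Psi>\<close> is
  \<open>S f = sup {\<theta> g. 0 \<le> g \<le> f}\<close> for \<open>f \<ge> 0\<close>. As each \<open>t\<close> is a homeomorphism, composition with \<open>t\<close> maps
  the competitors \<open>g\<close> for \<open>f\<close> onto those for \<open>f \<circ> t\<close>, so the positive part of an invariant functional
  is again invariant.
\<close>

lemma exists_positive_part:
  assumes \<Phi>: "\<Phi> \<in> invariant_cone T" and \<Psi>: "\<Psi> \<in> invariant_cone T"
  shows "\<exists>\<Sigma>\<in>invariant_cone T. \<Sigma> - (\<Phi> - \<Psi>) \<in> invariant_cone T \<and>
    (\<forall>\<Omega>\<in>invariant_cone T. \<Omega> - (\<Phi> - \<Psi>) \<in> invariant_cone T \<longrightarrow> \<Omega> - \<Sigma> \<in> invariant_cone T)"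
proof -
  define \<theta> where "\<theta> = apply_functional (\<Phi> - \<Psi>)"
  define B where "B f = {g. continuous_on UNIV g \<and> (\<forall>x. 0 \<le> g x \<and> g x \<le> f x)}" for f :: "'a \<Rightarrow> real"
  define S where "S f = (SUP g\<in>B f. \<theta> g)" for f
  interpret F: positive_functional "apply_functional \<Phi>"
    by (rule positive_functional_apply_functional[OF \<Phi>])
  have \<theta>_add: "\<theta> (\<lambda>x. f x + g x) = \<theta> f + \<theta> g" if "continuous_on UNIV f" "continuous_on UNIV g" for f g
    unfolding \<theta>_def using that by (rule apply_functional_add)
  have \<theta>_scale: "\<theta> (\<lambda>x. c * f x) = c * \<theta> f" if "continuous_on UNIV f" for f c
    unfolding \<theta>_def using that by (rule apply_functional_scale)
  have \<theta>_zero: "\<theta> (\<lambda>_. 0) = 0"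
    using \<theta>_scale[of "\<lambda>_. 0" 0] by simp
  have bound: "\<theta> g \<le> apply_functional \<Phi> f" if "continuous_on UNIV f" "g \<in> B f" for f g
    using F.mono[of g f] invariant_cone_nonneg[OF \<Psi>, of g] that by (auto simp: B_def \<theta>_def)
  have bdd: "bdd_above (\<theta> ` B f)" if "continuous_on UNIV f" for f
    using bound[OF that] by (auto simp: bdd_above_def)
  have ne: "(\<lambda>_. 0) \<in> B f" if "\<And>x. 0 \<le> f x" for f
    using that by (simp add: B_def)
  have S_upper: "\<theta> g \<le> S f" if "continuous_on UNIV f" "g \<in> B f" for f g
    unfolding S_def using that by (intro cSUP_upper bdd)
  have S_least: "S f \<le> c" if "\<And>x. 0 \<le> f x" "\<And>g. g \<in> B f \<Longrightarrow> \<theta> g \<le> c" for f c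
    unfolding S_def using that ne[of f] by (intro cSUP_least) auto
  have S_nonneg: "0 \<le> S f" if "continuous_on UNIV f" "\<And>x. 0 \<le> f x" for f
    using S_upper[OF that(1) ne] that(2) \<theta>_zero by simp
  have S_add: "S (\<lambda>x. f x + g x) = S f + S g"
    if f: "continuous_on UNIV f" "\<And>x. 0 \<le> f x" and g: "continuous_on UNIV g" "\<And>x. 0 \<le> g x" for f g
  proof (rule antisym)
    have fg: "continuous_on UNIV (\<lambda>x. f x + g x)"
      by (intro continuous_intros f g)
    show "S (\<lambda>x. f x + g x) \<le> S f + S g"
    proof (rule S_least)
      fix h assume h: "h \<in> B (\<lambda>x. f x + g x)"
      \<comment> \<open>Riesz decomposition of \<open>h \<le> f + g\<close> into a part below \<open>f\<close> and a part below \<open>g\<close>.\<close>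
      define h1 where "h1 x = min (h x) (f x)" for x
      define h2 where "h2 x = h x - min (h x) (f x)" for x
      have c: "continuous_on UNIV h1" "continuous_on UNIV h2"
        using h f unfolding h1_def h2_def B_def by (auto intro!: continuous_intros)
      have "0 \<le> h x" "h x \<le> g x + f x" for x
        using h by (simp_all add: B_def add.commute)
      then have "h1 \<in> B f" "h2 \<in> B g"
        using c f(2) g(2) by (auto simp: B_def h1_def h2_def min_def diff_le_eq)
      moreover have "h = (\<lambda>x. h1 x + h2 x)"
        by (auto simp: h1_def h2_def)
      then have "\<theta> h = \<theta> h1 + \<theta> h2"
        using \<theta>_add[OF c] by simp
      ultimately show "\<theta> h \<le> S f + S g"
        using S_upper f g by (metis add_mono)
    qed (simp add: f g)
    have "S f \<le> S (\<lambda>x. f x + g x) - S g"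
    proof (rule S_least[OF f(2)])
      fix h1 assume h1: "h1 \<in> B f"
      have "S g \<le> S (\<lambda>x. f x + g x) - \<theta> h1"
      proof (rule S_least[OF g(2)])
        fix h2 assume h2: "h2 \<in> B g"
        have "(\<lambda>x. h1 x + h2 x) \<in> B (\<lambda>x. f x + g x)"
          using h1 h2 by (auto simp: B_def intro!: continuous_intros add_mono)
        then have "\<theta> (\<lambda>x. h1 x + h2 x) \<le> S (\<lambda>x. f x + g x)"
          by (rule S_upper[OF fg])
        then show "\<theta> h2 \<le> S (\<lambda>x. f x + g x) - \<theta> h1"
          using \<theta>_add[of h1 h2] h1 h2 by (simp add: B_def)
      qed
      then show "\<theta> h1 \<le> S (\<lambda>x. f x + g x) - S g" by simp
    qed
    then show "S f + S g \<le> S (\<lambda>x. f x + g x)" by simp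
  qed
  have S_scale_le: "c * S f \<le> S (\<lambda>x. c * f x)" if "continuous_on UNIV f" "\<And>x. 0 \<le> f x" "c > 0" for f c
  proof -
    have "S f \<le> S (\<lambda>x. c * f x) / c"
    proof (rule S_least[OF that(2)])
      fix g assume g: "g \<in> B f"
      then have "(\<lambda>x. c * g x) \<in> B (\<lambda>x. c * f x)"
        using that by (auto simp: B_def intro!: continuous_intros)
      then have "\<theta> (\<lambda>x. c * g x) \<le> S (\<lambda>x. c * f x)"
        using that by (intro S_upper continuous_intros)
      then show "\<theta> g \<le> S (\<lambda>x. c * f x) / c"
        using g \<theta>_scale[of g c] that(3) by (simp add: B_def field_simps)
    qed
    then show ?thesis using that(3) by (simp add: field_simps)
  qed
  have S_scale: "S (\<lambda>x. c * f x) = c * S f" if f: "continuous_on UNIV f" "\<And>x. 0 \<le> f x" and c: "c \<ge> 0" for f c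
  proof (cases "c = 0")
    case True
    then show ?thesis
      using S_add[of "\<lambda>_. 0" "\<lambda>_. 0"] by simp
  next
    case False
    then have "c > 0" using c by simp
    moreover have "(1 / c) * S (\<lambda>x. c * f x) \<le> S (\<lambda>x. (1 / c) * (c * f x))"
      using f \<open>c > 0\<close> by (intro S_scale_le continuous_intros) auto
    ultimately show ?thesis
      using S_scale_le[OF f, of c] by (intro antisym) (auto simp: field_simps)
  qed
  have "\<exists>G. positive_functional G \<and> (\<forall>f. continuous_on UNIV f \<longrightarrow> (\<forall>x. 0 \<le> f x) \<longrightarrow> G f = S f)"
    by (rule positive_functional_extension) (simp_all add: S_add S_scale S_nonneg)
  then obtain G where G: "positive_functional G"
    and GS: "\<And>f. continuous_on UNIV f \<Longrightarrow> (\<And>x. 0 \<le> f x) \<Longrightarrow> G f = S f"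
    by blast
  interpret G: positive_functional G by fact
  have S_invariant: "S (\<lambda>x. f (t x)) = S f" if t: "t \<in> T" and f: "continuous_on UNIV f" "\<And>x. 0 \<le> f x" for t f
  proof (rule antisym)
    have \<theta>_inv: "\<theta> (\<lambda>x. g (t x)) = \<theta> g" if "continuous_on UNIV g" for g
      using invariant_cone_invariant[OF \<Phi> t that] invariant_cone_invariant[OF \<Psi> t that] by (simp add: \<theta>_def)
    show "S f \<le> S (\<lambda>x. f (t x))"
    proof (rule S_least[OF f(2)])
      fix g assume g: "g \<in> B f"
      then have "(\<lambda>x. g (t x)) \<in> B (\<lambda>x. f (t x))"
        using continuous_on_compose_dynamics[OF t, of g] by (simp add: B_def)
      then have "\<theta> (\<lambda>x. g (t x)) \<le> S (\<lambda>x. f (t x))"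
        by (rule S_upper[OF continuous_on_compose_dynamics[OF t f(1)]])
      then show "\<theta> g \<le> S (\<lambda>x. f (t x))"
        using \<theta>_inv[of g] g by (simp add: B_def)
    qed
    show "S (\<lambda>x. f (t x)) \<le> S f"
    proof (rule S_least[OF f(2)])
      fix g assume g: "g \<in> B (\<lambda>x. f (t x))"
      define h where "h x = g (inv t x)" for x
      have ht: "(\<lambda>x. h (t x)) = g"
        using bij[OF t] by (simp add: h_def bij_is_inj)
      have ti: "t (inv t x) = x" for x
        using bij[OF t] by (simp add: bij_is_surj surj_f_inv_f)
      have hB: "h \<in> B f"
        unfolding B_def mem_Collect_eq
      proof (intro conjI allI)
        show "continuous_on UNIV h"
          using g continuous_inv[OF t] unfolding h_def B_def by (auto intro: continuous_on_compose2)
        fix x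
        have "0 \<le> g (inv t x)" "g (inv t x) \<le> f (t (inv t x))"
          using g by (simp_all add: B_def)
        then show "0 \<le> h x" "h x \<le> f x"
          by (simp_all add: h_def ti)
      qed
      then show "\<theta> g \<le> S f"
        using S_upper[OF f(1) hB] \<theta>_inv[of h] ht by (simp add: B_def)
    qed
  qed
  define \<Sigma> where "\<Sigma> = functional_of G"
  have S: "apply_functional \<Sigma> f = G f" if "continuous_on UNIV f" for f
    unfolding \<Sigma>_def by (rule apply_functional_of[OF G that])
  have inv: "\<Sigma> \<in> invariant_cone T"
    unfolding \<Sigma>_def
  proof (rule functional_of_in_invariant_cone[OF G])
    fix t and f :: "'a \<Rightarrow> real" assume t: "t \<in> T" and f: "continuous_on UNIV f"
    note ft = continuous_on_compose_dynamics[OF t]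
    have p: "continuous_on UNIV (\<lambda>x. max 0 (f x))" "continuous_on UNIV (\<lambda>x. max 0 (- f x))"
      by (intro continuous_intros f)+
    have "G f = G (\<lambda>x. max 0 (f x) - max 0 (- f x))"
      by (rule arg_cong[of _ _ G]) auto
    also have "\<dots> = S (\<lambda>x. max 0 (f x)) - S (\<lambda>x. max 0 (- f x))"
      using G.diff[OF p] p by (simp add: GS)
    also have "\<dots> = S (\<lambda>x. max 0 (f (t x))) - S (\<lambda>x. max 0 (- f (t x)))"
      using S_invariant[OF t p(1)] S_invariant[OF t p(2)] by simp
    also have "\<dots> = G (\<lambda>x. max 0 (f (t x)) - max 0 (- f (t x)))"
      using G.diff[OF ft[OF p(1)] ft[OF p(2)]] ft[OF p(1)] ft[OF p(2)] by (simp add: GS)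
    also have "\<dots> = G (\<lambda>x. f (t x))"
      by (rule arg_cong[of _ _ G]) auto
    finally show "G (\<lambda>x. f (t x)) = G f" ..
  qed
  have sub: "\<Lambda> - \<Lambda>' \<in> invariant_cone T"
    if "\<And>f. continuous_on UNIV f \<Longrightarrow> (\<And>x. 0 \<le> f x) \<Longrightarrow> apply_functional \<Lambda>' f \<le> apply_functional \<Lambda> f"
      "\<And>t f. t \<in> T \<Longrightarrow> continuous_on UNIV f \<Longrightarrow> apply_functional \<Lambda> (\<lambda>x. f (t x)) = apply_functional \<Lambda> f"
      "\<And>t f. t \<in> T \<Longrightarrow> continuous_on UNIV f \<Longrightarrow> apply_functional \<Lambda>' (\<lambda>x. f (t x)) = apply_functional \<Lambda>' f"
    for \<Lambda> \<Lambda>'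
    using that by (simp add: invariant_cone_def)
  have "\<Sigma> - (\<Phi> - \<Psi>) \<in> invariant_cone T"
  proof (rule sub)
    fix f :: "'a \<Rightarrow> real" assume f: "continuous_on UNIV f" "\<And>x. 0 \<le> f x"
    then have "f \<in> B f" by (simp add: B_def)
    then show "apply_functional (\<Phi> - \<Psi>) f \<le> apply_functional \<Sigma> f"
      using S_upper[OF f(1)] f by (simp add: S GS \<theta>_def)
  qed (use inv \<Phi> \<Psi> in \<open>auto simp: invariant_cone_invariant\<close>)
  moreover have "\<Omega> - \<Sigma> \<in> invariant_cone T"
    if \<Omega>: "\<Omega> \<in> invariant_cone T" "\<Omega> - (\<Phi> - \<Psi>) \<in> invariant_cone T" for \<Omega>
  proof (rule sub)
    fix f :: "'a \<Rightarrow> real" assume f: "continuous_on UNIV f" "\<And>x. 0 \<le> f x"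
    interpret O: positive_functional "apply_functional \<Omega>"
      by (rule positive_functional_apply_functional[OF \<Omega>(1)])
    have "S f \<le> apply_functional \<Omega> f"
    proof (rule S_least[OF f(2)])
      fix g assume g: "g \<in> B f"
      have "\<theta> g \<le> apply_functional \<Omega> g"
        using invariant_cone_nonneg[OF \<Omega>(2), of g] g by (simp add: B_def \<theta>_def)
      also have "\<dots> \<le> apply_functional \<Omega> f"
        using g f by (intro O.mono) (auto simp: B_def)
      finally show "\<theta> g \<le> apply_functional \<Omega> f" .
    qed
    then show "apply_functional \<Sigma> f \<le> apply_functional \<Omega> f"
      using f by (simp add: S GS)
  qed (use inv \<Omega> in \<open>auto simp: invariant_cone_invariant\<close>)
  ultimately show ?thesis using inv by blast
qed

lemma choquet_simplex_invariant_states: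
  assumes ne: "invariant_states T \<noteq> {}"
  shows "choquet_simplex vague_topology (invariant_states T)"
  unfolding choquet_simplex_def
proof (intro conjI ne locally_convex_strong_operator_topology convex_invariant_states
    compactin_invariant_states lattice_of_positive_parts)
  let ?P = "simplex_cone (invariant_states T)"
  note P = simplex_cone_invariant_states[OF ne]
  show "0 \<in> ?P"
    unfolding P by (rule image_eqI[of _ _ 0]) (auto simp: zero_prod_def invariant_cone_zero)
  show "x + y \<in> ?P" if "x \<in> ?P" "y \<in> ?P" for x y
  proof -
    obtain \<Phi> \<Psi> where "\<Phi> \<in> invariant_cone T" "\<Psi> \<in> invariant_cone T"
        "x = (\<Phi>, apply_functional \<Phi> (\<lambda>_. 1))" "y = (\<Psi>, apply_functional \<Psi> (\<lambda>_. 1))"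
      using \<open>x \<in> ?P\<close> \<open>y \<in> ?P\<close> unfolding P by blast
    then show ?thesis
      unfolding P by (intro image_eqI[of _ _ "\<Phi> + \<Psi>"]) (simp_all add: invariant_cone_add)
  qed
  show "x = 0" if x: "x \<in> ?P" "- x \<in> ?P" for x
  proof -
    obtain \<Lambda> \<Lambda>' where L: "\<Lambda> \<in> invariant_cone T" "\<Lambda>' \<in> invariant_cone T"
        "x = (\<Lambda>, apply_functional \<Lambda> (\<lambda>_. 1))" "- x = (\<Lambda>', apply_functional \<Lambda>' (\<lambda>_. 1))"
      using x unfolding P by blast
    have "0 \<le> apply_functional \<Lambda> (\<lambda>_. 1)" "0 \<le> apply_functional \<Lambda>' (\<lambda>_. 1)"
      using L by (auto intro: invariant_cone_nonneg)
    with L have "apply_functional \<Lambda> (\<lambda>_. 1) = 0" by auto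
    with invariant_cone_eq_0[OF L(1)] L(3) show ?thesis
      by (simp add: zero_prod_def)
  qed
  show "\<exists>s\<in>?P. s - (x - y) \<in> ?P \<and> (\<forall>u\<in>?P. u - (x - y) \<in> ?P \<longrightarrow> u - s \<in> ?P)"
    if xy: "x \<in> ?P" "y \<in> ?P" for x y
  proof -
    obtain \<Phi> \<Psi> where FP: "\<Phi> \<in> invariant_cone T" "\<Psi> \<in> invariant_cone T"
        "x = (\<Phi>, apply_functional \<Phi> (\<lambda>_. 1))" "y = (\<Psi>, apply_functional \<Psi> (\<lambda>_. 1))"
      using xy unfolding P by blast
    obtain \<Sigma> where S: "\<Sigma> \<in> invariant_cone T" "\<Sigma> - (\<Phi> - \<Psi>) \<in> invariant_cone T"
        "\<And>\<Omega>. \<Omega> \<in> invariant_cone T \<Longrightarrow> \<Omega> - (\<Phi> - \<Psi>) \<in> invariant_cone T \<Longrightarrow> \<Omega> - \<Sigma> \<in> invariant_cone T"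
      using exists_positive_part[OF FP(1,2)] by blast
    have mem: "(\<Lambda>, c) \<in> ?P \<longleftrightarrow> \<Lambda> \<in> invariant_cone T \<and> c = apply_functional \<Lambda> (\<lambda>_. 1)" for \<Lambda> c
      unfolding P by auto
    show ?thesis
      using S by (intro bexI[of _ "(\<Sigma>, apply_functional \<Sigma> (\<lambda>_. 1))"]) (auto simp: FP(3,4) mem)
  qed
qed

end

section \<open>Extreme states and generic independence\<close>

definition relabel :: "('i \<Rightarrow> 'i) \<Rightarrow> ('i \<Rightarrow> 'b) \<Rightarrow> 'i \<Rightarrow> 'b" where
  "relabel g b = (\<lambda>i. b (g i))"

lemma relabel_id [simp]: "relabel id b = b"
  by (simp add: relabel_def)

lemma continuous_on_relabel: "continuous_on A (relabel g :: ('i \<Rightarrow> 'b::topological_space) \<Rightarrow> _)"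
  unfolding relabel_def
  by (intro continuous_on_coordinatewise_then_product continuous_on_subset[OF continuous_on_product_coordinates]) auto

lemma inv_relabel:
  fixes g :: "'a \<Rightarrow> 'a"
  assumes "bij g"
  shows "bij (relabel g :: ('a \<Rightarrow> 'b) \<Rightarrow> _)" "inv (relabel g) = (relabel (inv g) :: ('a \<Rightarrow> 'b) \<Rightarrow> _)"
proof -
  have 1: "relabel (inv g) (relabel g b) = b" for b :: "'a \<Rightarrow> 'b"
    using assms by (simp add: relabel_def bij_is_surj surj_f_inv_f)
  have 2: "relabel g (relabel (inv g) b) = b" for b :: "'a \<Rightarrow> 'b"
    using assms by (simp add: relabel_def bij_is_inj)
  show "bij (relabel g :: ('a \<Rightarrow> 'b) \<Rightarrow> _)"
    by (rule o_bij[of "relabel (inv g)"]) (simp_all add: fun_eq_iff 1 2)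
  show "inv (relabel g) = (relabel (inv g) :: ('a \<Rightarrow> 'b) \<Rightarrow> _)"
    by (rule inv_equality) (simp_all add: 1 2)
qed

definition cylinder :: "'i set \<Rightarrow> (('i \<Rightarrow> 'b::topological_space) \<Rightarrow> real) \<Rightarrow> bool" where
  "cylinder S f \<longleftrightarrow> continuous_on UNIV f \<and> (\<forall>b b'. (\<forall>i\<in>S. b i = b' i) \<longrightarrow> f b = f b')"

lemma cylinderD:
  assumes "cylinder S f"
  shows "continuous_on UNIV f" "(\<And>i. i \<in> S \<Longrightarrow> b i = b' i) \<Longrightarrow> f b = f b'"
  using assms by (auto simp: cylinder_def)

lemma cylinder_mono: "cylinder S f \<Longrightarrow> S \<subseteq> S' \<Longrightarrow> cylinder S' f"
  unfolding cylinder_def by (meson subsetD)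

lemma cylinder_relabel:
  assumes "cylinder S f" shows "cylinder (g ` S) (\<lambda>b. f (relabel g b))"
  unfolding cylinder_def
proof (intro conjI allI impI)
  show "continuous_on UNIV (\<lambda>b. f (relabel g b))"
    using cylinderD(1)[OF assms] continuous_on_relabel by (rule continuous_on_compose2) simp
  fix b b' :: "'a \<Rightarrow> 'b" assume "\<forall>i\<in>g ` S. b i = b' i"
  then show "f (relabel g b) = f (relabel g b')"
    by (intro cylinderD(2)[OF assms]) (simp add: relabel_def)
qed

lemma cylinder_const: "cylinder S (\<lambda>_. c)"
  by (simp add: cylinder_def)

lemma cylinder_compose:
  assumes "cylinder S f" "continuous_on UNIV k" shows "cylinder S (\<lambda>b. k (f b))"
  using assms unfolding cylinder_def by (auto intro: continuous_on_compose2) metis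

lemma cylinder_add: "cylinder S f \<Longrightarrow> cylinder S g \<Longrightarrow> cylinder S (\<lambda>b. f b + g b)"
  unfolding cylinder_def by (auto intro!: continuous_intros) metis

text \<open>
  What the affine group contributes to the closedness of the extreme points is the assumption
  \<open>generic\<close>: the maps \<open>\<gamma> m\<close> push any finite \<open>S\<close> into a position relative to \<open>S\<close> that is, up to the
  group, eventually the same for all \<open>m\<close>, and remains so when \<open>S\<close> itself is moved by some \<open>\<sigma>\<close>. The base
  point \<open>b0\<close> is used to truncate configurations to finitely many coordinates.
\<close>

locale generic_relabelling =
  fixes G :: "('i::countable \<Rightarrow> 'i) set" and \<gamma> :: "nat \<Rightarrow> 'i \<Rightarrow> 'i" and b0 :: "'b::metric_space"
  assumes cptB: "compact (UNIV :: 'b set)"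
    and bijG: "g \<in> G \<Longrightarrow> bij g"
    and id_in_G: "id \<in> G"
    and \<gamma>_in_G: "\<gamma> m \<in> G"
    and generic: "finite S \<Longrightarrow> \<sigma> \<in> G \<Longrightarrow>
      \<exists>M. \<forall>m\<ge>M. \<forall>m'\<ge>M. \<exists>h\<in>G. \<forall>i\<in>S. h i = \<sigma> i \<and> h (\<gamma> m i) = \<gamma> m' i"
begin

definition T :: "(('i \<Rightarrow> 'b) \<Rightarrow> 'i \<Rightarrow> 'b) set" where
  "T = relabel ` G"

sublocale compact_dynamics T
proof
  show "compact (UNIV :: ('i \<Rightarrow> 'b) set)"
    using compactin_PiE[of "\<lambda>_. euclidean" "UNIV :: 'i set" "\<lambda>_. UNIV :: 'b set"] cptB
    by (simp add: euclidean_product_topology PiE_UNIV_domain)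
qed (auto simp: T_def continuous_on_relabel inv_relabel bijG)

abbreviation "states \<equiv> invariant_states T"

lemma state_positive: "\<Lambda> \<in> states \<Longrightarrow> positive_functional (apply_functional \<Lambda>)"
  by (rule positive_functional_apply_functional[OF invariant_statesD(1)])

lemma state_invariant:
  "\<Lambda> \<in> states \<Longrightarrow> g \<in> G \<Longrightarrow> continuous_on UNIV f \<Longrightarrow>
     apply_functional \<Lambda> (\<lambda>b. f (relabel g b)) = apply_functional \<Lambda> f"
  by (rule invariant_cone_invariant[OF invariant_statesD(1)]) (auto simp: T_def)

lemma cont_relabel: "continuous_on UNIV f \<Longrightarrow> continuous_on UNIV (\<lambda>b. f (relabel g b))"
  for f :: "('i \<Rightarrow> 'b) \<Rightarrow> real"
  by (rule continuous_on_compose2[OF _ continuous_on_relabel]) auto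

text \<open>
  Uniform continuity: resetting all coordinates outside a large finite set to \<open>b0\<close> moves every
  configuration by a uniformly small amount.
\<close>

lemma cylinder_approximation:
  fixes f :: "('i \<Rightarrow> 'b) \<Rightarrow> real"
  assumes f: "continuous_on UNIV f" and e: "e > 0"
  obtains S f' where "finite S" "cylinder S f'" "\<And>b. \<bar>f b - f' b\<bar> \<le> e"
proof -
  have "uniformly_continuous_on UNIV f"
    by (rule compact_uniformly_continuous[OF f cpt])
  then obtain d where d: "d > 0" "\<And>b b'. dist b b' < d \<Longrightarrow> dist (f b) (f b') < e"
    unfolding uniformly_continuous_on_def using e by (metis UNIV_I)
  obtain N where N: "(1 / 2 :: real) ^ N < d"
    using real_arch_pow_inv[OF d(1), of "1 / 2"] by auto
  define S where "S = (from_nat :: nat \<Rightarrow> 'i) ` {..N}"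
  define r where "r b = (\<lambda>i. if i \<in> S then b i else b0)" for b :: "'i \<Rightarrow> 'b"
  have contr: "continuous_on UNIV r"
    unfolding r_def
  proof (rule continuous_on_coordinatewise_then_product)
    fix i show "continuous_on UNIV (\<lambda>b::'i \<Rightarrow> 'b. if i \<in> S then b i else b0)"
      by (cases "i \<in> S") auto
  qed
  have near: "dist b (r b) < d" for b
  proof -
    have "{dist (b (from_nat n)) (r b (from_nat n)) | n. n \<le> N} = {0}"
      by (auto simp: r_def S_def)
    then show ?thesis
      using dist_fun_le_dist_first_terms[of b "r b" N] N by simp
  qed
  show thesis
  proof (rule that)
    show "finite S" by (simp add: S_def)
    show "cylinder S (\<lambda>b. f (r b))"
      unfolding cylinder_def
    proof (intro conjI allI impI)
      show "continuous_on UNIV (\<lambda>b. f (r b))"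
        using f contr by (rule continuous_on_compose2) simp
      fix b b' :: "'i \<Rightarrow> 'b" assume "\<forall>i\<in>S. b i = b' i"
      then have "r b = r b'" by (auto simp: r_def)
      then show "f (r b) = f (r b')" by simp
    qed
    show "\<bar>f b - f (r b)\<bar> \<le> e" for b
      using d(2)[OF near[of b]] by (simp add: dist_real_def)
  qed
qed

lemma state_bound:
  assumes "\<Lambda> \<in> states" "continuous_on UNIV f" "\<And>b. \<bar>f b\<bar> \<le> c"
  shows "\<bar>apply_functional \<Lambda> f\<bar> \<le> c"
  using positive_functional.bound[OF state_positive[OF assms(1)] assms(2,3)]
    invariant_statesD(2)[OF assms(1)] by simp

lemma states_eqI:
  assumes L: "\<Lambda> \<in> states" "\<Lambda>' \<in> states"
    and eq: "\<And>S f. finite S \<Longrightarrow> cylinder S f \<Longrightarrow> apply_functional \<Lambda> f = apply_functional \<Lambda>' f"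
  shows "\<Lambda> = \<Lambda>'"
proof (rule functional_eqI)
  fix f :: "('i \<Rightarrow> 'b) \<Rightarrow> real" assume f: "continuous_on UNIV f"
  have "\<bar>apply_functional \<Lambda> f - apply_functional \<Lambda>' f\<bar> \<le> 0 + e" if e: "e > 0" for e
  proof -
    obtain S f' where S: "finite S" "cylinder S f'" "\<And>b. \<bar>f b - f' b\<bar> \<le> e / 2"
      using cylinder_approximation[OF f, of "e / 2"] e by auto
    have c: "continuous_on UNIV (\<lambda>b. f b - f' b)"
      by (intro continuous_intros f cylinderD(1)[OF S(2)])
    have "\<bar>apply_functional \<Lambda>'' f - apply_functional \<Lambda>'' f'\<bar> \<le> e / 2" if "\<Lambda>'' \<in> states" for \<Lambda>''
      using state_bound[OF that c S(3)]
        positive_functional.diff[OF state_positive[OF that] f cylinderD(1)[OF S(2)]] by simp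
    from this[OF L(1)] this[OF L(2)] show ?thesis
      using eq[OF S(1,2)] by linarith
  qed
  then show "apply_functional \<Lambda> f = apply_functional \<Lambda>' f"
    using field_le_epsilon[of "\<bar>apply_functional \<Lambda> f - apply_functional \<Lambda>' f\<bar>" 0] by force
qed

lemma states_nonempty: "states \<noteq> {}"
proof -
  have F: "positive_functional (\<lambda>f. f (\<lambda>_::'i. b0))"
    by unfold_locales auto
  have "functional_of (\<lambda>f. f (\<lambda>_::'i. b0)) \<in> invariant_cone T"
    by (rule functional_of_in_invariant_cone[OF F]) (auto simp: T_def relabel_def)
  then have "functional_of (\<lambda>f. f (\<lambda>_::'i. b0)) \<in> states"
    by (simp add: invariant_states_def apply_functional_of[OF F])
  then show ?thesis by blast
qed

text \<open>
  The threshold must depend on \<open>S\<close> only, not on the state, for the conditions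
  in \<open>generically_independent\<close> to define a closed set.
\<close>

definition threshold :: "'i set \<Rightarrow> nat" where
  "threshold S = (SOME M. \<forall>m\<ge>M. \<forall>m'\<ge>M. \<exists>h\<in>G. \<forall>i\<in>S. h i = i \<and> h (\<gamma> m i) = \<gamma> m' i)"

lemma threshold:
  assumes "finite S" "threshold S \<le> m" "threshold S \<le> m'"
  shows "\<exists>h\<in>G. \<forall>i\<in>S. h i = i \<and> h (\<gamma> m i) = \<gamma> m' i"
  using someI_ex[OF generic[OF assms(1) id_in_G, unfolded id_apply]] assms(2,3)
  unfolding threshold_def by blast

lemma state_generic_pair:
  assumes L: "\<Lambda> \<in> states" and f: "cylinder S f" and g: "cylinder S g"
    and h: "h \<in> G" "\<And>i. i \<in> S \<Longrightarrow> h i = \<sigma> i" "\<And>i. i \<in> S \<Longrightarrow> h (\<gamma> m i) = \<gamma> m' i"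
  shows "apply_functional \<Lambda> (\<lambda>b. f (relabel \<sigma> b) * g (relabel (\<gamma> m') b)) =
    apply_functional \<Lambda> (\<lambda>b. f b * g (relabel (\<gamma> m) b))"
proof -
  have "f (relabel h b) = f (relabel \<sigma> b)" for b
    by (rule cylinderD(2)[OF f]) (simp add: relabel_def h(2))
  moreover have "g (relabel (\<gamma> m) (relabel h b)) = g (relabel (\<gamma> m') b)" for b
    by (rule cylinderD(2)[OF g]) (simp add: relabel_def h(3))
  moreover have "continuous_on UNIV (\<lambda>b. f b * g (relabel (\<gamma> m) b))"
    by (intro continuous_intros cont_relabel cylinderD(1)[OF f] cylinderD(1)[OF g])
  ultimately show ?thesis
    using state_invariant[OF L h(1), of "\<lambda>b. f b * g (relabel (\<gamma> m) b)"] by simp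
qed

lemma state_generic_pair_const:
  assumes L: "\<Lambda> \<in> states" and f: "cylinder S f" and g: "cylinder S g" and S: "finite S"
    and m: "threshold S \<le> m" "threshold S \<le> m'"
  shows "apply_functional \<Lambda> (\<lambda>b. f b * g (relabel (\<gamma> m') b)) =
    apply_functional \<Lambda> (\<lambda>b. f b * g (relabel (\<gamma> m) b))"
proof -
  obtain h where "h \<in> G" "\<forall>i\<in>S. h i = i \<and> h (\<gamma> m i) = \<gamma> m' i"
    using threshold[OF S m] by blast
  then show ?thesis
    using state_generic_pair[OF L f g, of h id m m'] by simp
qed

text \<open>
  The closed condition that characterises the extreme states. It says that observables \<open>f\<close> and \<open>g\<close> seen
  in generic position are independent.
\<close>

definition generically_independent :: "((('i \<Rightarrow> 'b) \<Rightarrow>\<^sub>C real) \<Rightarrow>\<^sub>L real) \<Rightarrow> bool" where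
  "generically_independent \<Lambda> \<longleftrightarrow>
     (\<forall>S f g m. finite S \<longrightarrow> cylinder S f \<longrightarrow> cylinder S g \<longrightarrow> threshold S \<le> m \<longrightarrow>
        apply_functional \<Lambda> (\<lambda>b. f b * g (relabel (\<gamma> m) b)) =
        apply_functional \<Lambda> f * apply_functional \<Lambda> g)"

lemma extreme_imp_scalar:
  assumes ext: "\<Lambda> extreme_point_of states"
    and \<phi>: "\<phi> \<in> invariant_cone T" "\<Lambda> - \<phi> \<in> invariant_cone T"
    and t: "apply_functional \<phi> (\<lambda>_. 1) = t" "0 < t" "t < 1"
  shows "\<phi> = t *\<^sub>R \<Lambda>"
proof -
  have L: "\<Lambda> \<in> states" using ext by (simp add: extreme_point_of_def)
  define a where "a = (1 / t) *\<^sub>R \<phi>"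
  define c where "c = (1 / (1 - t)) *\<^sub>R (\<Lambda> - \<phi>)"
  have "a \<in> states" "c \<in> states"
    using \<phi> t invariant_statesD(2)[OF L]
    by (auto simp: a_def c_def invariant_states_def intro!: invariant_cone_scale)
  then have "\<Lambda> \<notin> open_segment a c"
    using ext by (simp add: extreme_point_of_def)
  moreover have \<Lambda>: "\<Lambda> = (1 - (1 - t)) *\<^sub>R a + (1 - t) *\<^sub>R c"
    using t by (simp add: a_def c_def)
  moreover have "\<Lambda> \<in> open_segment a c" if "a \<noteq> c"
    unfolding in_segment using that t(2,3) \<Lambda> by (intro conjI exI[of _ "1 - t"]) simp_all
  ultimately have "a = c" by blast
  then have "\<Lambda> = a"
    using \<Lambda> by (simp add: scaleR_left_diff_distrib)
  then show ?thesis
    using t by (simp add: a_def)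
qed

text \<open>
  For \<open>g\<close> with \<open>0 \<le> g \<le> 1\<close>, the generic correlation \<open>\<Phi> F = lim \<Lambda> (F \<cdot> g \<circ> \<gamma> k)\<close> exists and is an invariant
  positive functional below \<open>\<Lambda>\<close>: the limit exists and does not change when \<open>F\<close> is relabelled because
  on cylinder functions the sequence is eventually constant, by genericity. If \<open>\<Lambda>\<close> is extreme,
  then \<open>\<Phi>\<close> must be the multiple \<open>\<Phi> 1 = \<Lambda> g\<close> of \<open>\<Lambda>\<close>. The range of \<open>g\<close> keeps this multiple away from \<open>0\<close>
  and \<open>1\<close>, so that both \<open>\<Phi>\<close> and \<open>\<Lambda> - \<Phi>\<close> can be normalised.
\<close>

lemma extreme_imp_product:
  assumes ext: "\<Lambda> extreme_point_of states" and S: "finite S" and f: "cylinder S f" and g: "cylinder S g"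
    and range: "\<And>b. 1 / 4 \<le> g b" "\<And>b. g b \<le> 3 / 4" and m: "threshold S \<le> m"
  shows "apply_functional \<Lambda> (\<lambda>b. f b * g (relabel (\<gamma> m) b)) = apply_functional \<Lambda> f * apply_functional \<Lambda> g"
proof -
  have L: "\<Lambda> \<in> states" using ext by (simp add: extreme_point_of_def)
  interpret L: positive_functional "apply_functional \<Lambda>"
    by (rule state_positive[OF L])
  define W where "W k F = apply_functional \<Lambda> (\<lambda>b. F b * g (relabel (\<gamma> k) b))" for k F
  note gc = cylinderD(1)[OF g]
  have cW: "continuous_on UNIV (\<lambda>b. F b * g (relabel (\<gamma> k) b))" if "continuous_on UNIV F" for F k
    by (intro continuous_intros cont_relabel gc that)
  have g01: "0 \<le> g b" "g b \<le> 1" for b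
    using range[of b] by simp_all
  have W_add: "W k (\<lambda>b. F b + F' b) = W k F + W k F'" if "continuous_on UNIV F" "continuous_on UNIV F'" for k F F'
    using L.add[OF cW[OF that(1)] cW[OF that(2)], of k k] by (simp add: W_def distrib_right)
  have W_scale: "W k (\<lambda>b. c * F b) = c * W k F" if "continuous_on UNIV F" for k c F
    using L.scale[OF cW[OF that], of c k] by (simp add: W_def mult.assoc)
  have W_nonneg: "0 \<le> W k F" if "continuous_on UNIV F" "\<And>b. 0 \<le> F b" for k F
    unfolding W_def using that g01 by (intro L.nonneg cW mult_nonneg_nonneg)
  have W_le: "W k F \<le> apply_functional \<Lambda> F" if "continuous_on UNIV F" "\<And>b. 0 \<le> F b" for k F
    unfolding W_def using that g01 by (intro L.mono cW mult_left_le)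
  have W_near: "\<bar>W k F - W k F'\<bar> \<le> e"
    if F: "continuous_on UNIV F" "continuous_on UNIV F'" "\<And>b. \<bar>F b - F' b\<bar> \<le> e" for k F F' e
  proof -
    have "\<bar>(F b - F' b) * g (relabel (\<gamma> k) b)\<bar> \<le> e" for b
    proof -
      have "\<bar>(F b - F' b) * g (relabel (\<gamma> k) b)\<bar> \<le> \<bar>F b - F' b\<bar> * 1"
        unfolding abs_mult using range[of "relabel (\<gamma> k) b"] by (intro mult_left_mono) auto
      then show ?thesis using F(3)[of b] by simp
    qed
    moreover have "continuous_on UNIV (\<lambda>b. F b - F' b)"
      by (intro continuous_intros F)
    ultimately have "\<bar>W k (\<lambda>b. F b - F' b)\<bar> \<le> e"
      unfolding W_def by (intro state_bound[OF L] cW)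
    moreover have "W k (\<lambda>b. F b - F' b) = W k F - W k F'"
      using L.diff[OF cW[OF F(1)] cW[OF F(2)], of k k] by (simp add: W_def left_diff_distrib)
    ultimately show ?thesis by simp
  qed
  \<comment> \<open>With \<open>\<sigma> = id\<close> this makes \<open>W k F\<close> a Cauchy sequence; for general \<open>\<sigma>\<close> it makes the limit invariant.\<close>
  have key: "\<exists>M. \<forall>k\<ge>M. \<forall>k'\<ge>M. \<bar>W k' (\<lambda>b. F (relabel \<sigma> b)) - W k F\<bar> \<le> e"
    if F: "continuous_on UNIV F" and \<sigma>: "\<sigma> \<in> G" and e: "e > 0" for F \<sigma> e
  proof -
    obtain S' F' where S': "finite S'" "cylinder S' F'" "\<And>b. \<bar>F b - F' b\<bar> \<le> e / 2"
      using cylinder_approximation[OF F, of "e / 2"] e by auto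
    note F'c = cylinderD(1)[OF S'(2)]
    obtain M where M: "\<And>k k'. k \<ge> M \<Longrightarrow> k' \<ge> M \<Longrightarrow>
        \<exists>h\<in>G. \<forall>i\<in>S \<union> S'. h i = \<sigma> i \<and> h (\<gamma> k i) = \<gamma> k' i"
      using generic[of "S \<union> S'" \<sigma>] S S'(1) \<sigma> by blast
    have "\<bar>W k' (\<lambda>b. F (relabel \<sigma> b)) - W k F\<bar> \<le> e" if k: "k \<ge> M" "k' \<ge> M" for k k'
    proof -
      obtain h where h: "h \<in> G" "\<forall>i\<in>S \<union> S'. h i = \<sigma> i \<and> h (\<gamma> k i) = \<gamma> k' i"
        using M[OF k] by blast
      have "W k' (\<lambda>b. F' (relabel \<sigma> b)) = W k F'"
        unfolding W_def using h
        by (intro state_generic_pair[OF L, of "S \<union> S'" _ _ h] cylinder_mono[OF S'(2)] cylinder_mono[OF g]) auto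
      moreover have "\<bar>W k' (\<lambda>b. F (relabel \<sigma> b)) - W k' (\<lambda>b. F' (relabel \<sigma> b))\<bar> \<le> e / 2"
        by (intro W_near cont_relabel F F'c S'(3))
      moreover have "\<bar>W k F - W k F'\<bar> \<le> e / 2"
        by (intro W_near F F'c S'(3))
      ultimately show ?thesis by linarith
    qed
    then show ?thesis by blast
  qed
  define \<Phi> where "\<Phi> F = lim (\<lambda>k. W k F)" for F
  have W_lim: "(\<lambda>k. W k F) \<longlonglongrightarrow> \<Phi> F" if F: "continuous_on UNIV F" for F
  proof -
    have "Cauchy (\<lambda>k. W k F)"
      unfolding Cauchy_def
    proof (intro allI impI)
      fix e :: real assume "e > 0"
      then obtain M where "\<forall>k\<ge>M. \<forall>k'\<ge>M. \<bar>W k' F - W k F\<bar> \<le> e / 2"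
        using key[OF F id_in_G, of "e / 2"] by auto
      with \<open>e > 0\<close> show "\<exists>M. \<forall>k\<ge>M. \<forall>k'\<ge>M. dist (W k F) (W k' F) < e"
        by (intro exI[of _ M]) (force simp: dist_real_def abs_minus_commute)
    qed
    then show ?thesis
      unfolding \<Phi>_def by (simp add: Cauchy_convergent_iff convergent_LIMSEQ_iff)
  qed
  have \<Phi>: "positive_functional \<Phi>"
  proof
    fix F F' :: "('i \<Rightarrow> 'b) \<Rightarrow> real" and c :: real assume F: "continuous_on UNIV F"
    have "(\<lambda>k. W k (\<lambda>b. c * F b)) \<longlonglongrightarrow> c * \<Phi> F"
      using tendsto_mult_left[OF W_lim[OF F], of c] by (simp add: W_scale[OF F])
    then show "\<Phi> (\<lambda>b. c * F b) = c * \<Phi> F"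
      by (intro LIMSEQ_unique[OF W_lim] continuous_intros F)
    {
      assume F': "continuous_on UNIV F'"
      have "(\<lambda>k. W k (\<lambda>b. F b + F' b)) \<longlonglongrightarrow> \<Phi> F + \<Phi> F'"
        using tendsto_add[OF W_lim[OF F] W_lim[OF F']] by (simp add: W_add[OF F F'])
      then show "\<Phi> (\<lambda>b. F b + F' b) = \<Phi> F + \<Phi> F'"
        by (intro LIMSEQ_unique[OF W_lim] continuous_intros F F')
    }
    assume "\<And>b. 0 \<le> F b"
    then show "0 \<le> \<Phi> F"
      using W_nonneg[OF F] by (intro LIMSEQ_le_const[OF W_lim[OF F]]) auto
  qed
  define \<phi> where "\<phi> = functional_of \<Phi>"
  have \<phi>_apply: "apply_functional \<phi> F = \<Phi> F" if "continuous_on UNIV F" for F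
    unfolding \<phi>_def by (rule apply_functional_of[OF \<Phi> that])
  have \<phi>_cone: "\<phi> \<in> invariant_cone T"
    unfolding \<phi>_def
  proof (rule functional_of_in_invariant_cone[OF \<Phi>])
    fix t and F :: "('i \<Rightarrow> 'b) \<Rightarrow> real" assume "t \<in> T" and F: "continuous_on UNIV F"
    then obtain \<sigma> where \<sigma>: "\<sigma> \<in> G" "t = relabel \<sigma>" by (auto simp: T_def)
    have "(\<lambda>k. W k (\<lambda>b. F (relabel \<sigma> b)) - W k F) \<longlonglongrightarrow> 0"
      unfolding LIMSEQ_iff
    proof (intro allI impI)
      fix e :: real assume "e > 0"
      then obtain M where "\<forall>k\<ge>M. \<forall>k'\<ge>M. \<bar>W k' (\<lambda>b. F (relabel \<sigma> b)) - W k F\<bar> \<le> e / 2"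
        using key[OF F \<sigma>(1), of "e / 2"] by auto
      with \<open>e > 0\<close> show "\<exists>M. \<forall>k\<ge>M. norm (W k (\<lambda>b. F (relabel \<sigma> b)) - W k F - 0) < e"
        by (intro exI[of _ M]) force
    qed
    moreover have "(\<lambda>k. W k (\<lambda>b. F (relabel \<sigma> b)) - W k F) \<longlonglongrightarrow> \<Phi> (\<lambda>b. F (relabel \<sigma> b)) - \<Phi> F"
      by (intro tendsto_diff W_lim cont_relabel F)
    ultimately show "\<Phi> (\<lambda>x. F (t x)) = \<Phi> F"
      using LIMSEQ_unique \<sigma>(2) by fastforce
  qed
  have \<phi>_le: "\<Lambda> - \<phi> \<in> invariant_cone T"
  proof -
    have "\<Phi> F \<le> apply_functional \<Lambda> F" if "continuous_on UNIV F" "\<And>b. 0 \<le> F b" for F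
      using W_le[OF that] by (intro LIMSEQ_le_const2[OF W_lim[OF that(1)]]) auto
    then show ?thesis
      using \<phi>_cone invariant_statesD(1)[OF L] by (simp add: invariant_cone_def \<phi>_apply)
  qed
  have "W k (\<lambda>_. 1) = apply_functional \<Lambda> g" for k
    using state_invariant[OF L \<gamma>_in_G gc] by (simp add: W_def)
  then have \<Phi>1: "\<Phi> (\<lambda>_. 1) = apply_functional \<Lambda> g"
    using W_lim[of "\<lambda>_. 1"] by (simp add: LIMSEQ_const_iff)
  have "1 / 4 \<le> apply_functional \<Lambda> g" "apply_functional \<Lambda> g \<le> 3 / 4"
    using L.mono[of "\<lambda>_. 1 / 4" g] L.mono[of g "\<lambda>_. 3 / 4"] range gc L.const[of "1 / 4"] L.const[of "3 / 4"]
      invariant_statesD(2)[OF L] by auto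
  then have "\<phi> = apply_functional \<Lambda> g *\<^sub>R \<Lambda>"
    using \<Phi>1 by (intro extreme_imp_scalar[OF ext \<phi>_cone \<phi>_le]) (auto simp: \<phi>_apply)
  then have "\<Phi> f = apply_functional \<Lambda> g * apply_functional \<Lambda> f"
    using \<phi>_apply[OF cylinderD(1)[OF f]] by simp
  moreover have "W k f = W m f" if "k \<ge> threshold S" for k
    unfolding W_def by (rule state_generic_pair_const[OF L f g S m that])
  then have "(\<lambda>k. W k f) \<longlonglongrightarrow> W m f"
    by (intro tendsto_eventually eventually_sequentiallyI[of "threshold S"])
  then have "\<Phi> f = W m f"
    using W_lim[OF cylinderD(1)[OF f]] LIMSEQ_unique by blast
  ultimately show ?thesis
    by (simp add: W_def mult.commute)
qed

text \<open>
  The product formula is affine in \<open>g\<close>, so the restriction on its range can be removed by rescaling.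
\<close>

lemma extreme_imp_generically_independent:
  assumes ext: "\<Lambda> extreme_point_of states"
  shows "generically_independent \<Lambda>"
  unfolding generically_independent_def
proof (intro allI impI)
  fix S m and f g :: "('i \<Rightarrow> 'b) \<Rightarrow> real"
  assume S: "finite S" and f: "cylinder S f" and g: "cylinder S g" and m: "threshold S \<le> m"
  have L: "\<Lambda> \<in> states" using ext by (simp add: extreme_point_of_def)
  interpret L: positive_functional "apply_functional \<Lambda>"
    by (rule state_positive[OF L])
  note fc = cylinderD(1)[OF f] and gc = cylinderD(1)[OF g]
  have "bounded (range g)"
    using compact_continuous_image[OF gc cpt] by (rule compact_imp_bounded)
  then obtain C where C: "C > 0" "\<And>b. \<bar>g b\<bar> \<le> C"
    by (auto simp: bounded_pos)
  define c where "c = 1 / (4 * C)"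
  define g' where "g' b = 1 / 2 + c * g b" for b
  have c: "c > 0" using C(1) by (simp add: c_def)
  have "\<bar>c * g b\<bar> \<le> 1 / 4" for b
    using C by (simp add: c_def abs_mult field_simps)
  then have "c * g b \<le> 1 / 4" "- (c * g b) \<le> 1 / 4" for b
    unfolding abs_le_iff by blast+
  note cg = this
  have range: "1 / 4 \<le> g' b" "g' b \<le> 3 / 4" for b
    using cg[of b] unfolding g'_def by linarith+
  have g': "cylinder S g'"
    unfolding g'_def by (rule cylinder_compose[OF g]) (intro continuous_intros)
  let ?A = "apply_functional \<Lambda>"
  have cc: "continuous_on UNIV (\<lambda>b. f b * g (relabel (\<gamma> m) b))"
    by (intro continuous_intros cont_relabel fc gc)
  have "?A (\<lambda>b. f b * g' (relabel (\<gamma> m) b)) = ?A (\<lambda>b. (1 / 2) * f b + c * (f b * g (relabel (\<gamma> m) b)))"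
    by (rule arg_cong[of _ _ ?A]) (auto simp: g'_def algebra_simps)
  also have "\<dots> = (1 / 2) * ?A f + c * ?A (\<lambda>b. f b * g (relabel (\<gamma> m) b))"
    using cc fc by (subst L.add) (auto simp: L.scale intro!: continuous_intros simp del: times_divide_eq_left)
  finally have "?A f * ?A g' = (1 / 2) * ?A f + c * ?A (\<lambda>b. f b * g (relabel (\<gamma> m) b))"
    using extreme_imp_product[OF ext S f g' range m] by simp
  moreover have "?A g' = 1 / 2 + c * ?A g"
    using L.add[of "\<lambda>_. 1 / 2" "\<lambda>b. c * g b"] gc L.const[of "1 / 2"] L.scale[OF gc, of c] invariant_statesD(2)[OF L]
    by (simp add: g'_def[abs_def] continuous_on_mult_left)
  ultimately have "c * ?A (\<lambda>b. f b * g (relabel (\<gamma> m) b)) = c * (?A f * ?A g)"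
    by (auto simp: algebra_simps)
  then show "?A (\<lambda>b. f b * g (relabel (\<gamma> m) b)) = ?A f * ?A g"
    using c by simp
qed

text \<open>
  A law of large numbers by doubling: \<open>F\<close> and its generic translate \<open>F \<circ> \<gamma> m\<close> have the same mean under
  every state and are uncorrelated under \<open>\<Lambda>\<close>, so their average has the same means and half the
  \<open>\<Lambda>\<close>-variance.
\<close>

lemma variance_halving:
  assumes L: "\<Lambda> \<in> states" and ind: "generically_independent \<Lambda>"
    and f: "finite S" "cylinder S f"
  shows "\<exists>S' F. finite S' \<and> cylinder S' F \<and>
    (\<forall>\<Lambda>'\<in>states. apply_functional \<Lambda>' F = apply_functional \<Lambda>' f) \<and>
    apply_functional \<Lambda> (\<lambda>b. (F b - apply_functional \<Lambda> f)\<^sup>2) =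
      apply_functional \<Lambda> (\<lambda>b. (f b - apply_functional \<Lambda> f)\<^sup>2) / 2 ^ n"
proof (induction n)
  case 0
  then show ?case using f by auto
next
  case (Suc n)
  interpret L: positive_functional "apply_functional \<Lambda>"
    by (rule state_positive[OF L])
  let ?A = "apply_functional \<Lambda>"
  define c where "c = ?A f"
  obtain S' F where F: "finite S'" "cylinder S' F"
      "\<And>\<Lambda>'. \<Lambda>' \<in> states \<Longrightarrow> apply_functional \<Lambda>' F = apply_functional \<Lambda>' f"
      "?A (\<lambda>b. (F b - c)\<^sup>2) = ?A (\<lambda>b. (f b - c)\<^sup>2) / 2 ^ n"
    using Suc.IH unfolding c_def by blast
  note Fc = cylinderD(1)[OF F(2)]
  define m where "m = threshold S'"
  define F' where "F' b = (1 / 2) * (F b + F (relabel (\<gamma> m) b))" for b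
  have "cylinder (S' \<union> \<gamma> m ` S') F'"
    unfolding F'_def
    by (intro cylinder_compose[of _ _ "\<lambda>x. 1 / 2 * x"] cylinder_add continuous_intros
        cylinder_mono[OF F(2)] cylinder_mono[OF cylinder_relabel[OF F(2)]]) auto
  moreover have "apply_functional \<Lambda>' F' = apply_functional \<Lambda>' f" if L': "\<Lambda>' \<in> states" for \<Lambda>'
  proof -
    interpret L': positive_functional "apply_functional \<Lambda>'"
      by (rule state_positive[OF L'])
    have "apply_functional \<Lambda>' F' =
        (1 / 2) * (apply_functional \<Lambda>' F + apply_functional \<Lambda>' (\<lambda>b. F (relabel (\<gamma> m) b)))"
      unfolding F'_def using Fc cont_relabel[OF Fc]
      by (subst L'.scale) (auto simp: L'.add intro!: continuous_intros)
    then show ?thesis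
      using state_invariant[OF L' \<gamma>_in_G Fc] F(3)[OF L'] by simp
  qed
  moreover have "?A (\<lambda>b. (F' b - c)\<^sup>2) = ?A (\<lambda>b. (f b - c)\<^sup>2) / 2 ^ Suc n"
  proof -
    define D where "D b = F b - c" for b
    have D: "cylinder S' D"
      unfolding D_def by (rule cylinder_compose[OF F(2)]) (intro continuous_intros)
    note Dc = cylinderD(1)[OF D]
    have A_D: "?A D = 0"
      using L.diff[OF Fc, of "\<lambda>_. c"] L.const[of c] F(3)[OF L] invariant_statesD(2)[OF L]
      by (simp add: D_def[abs_def] c_def)
    have c1: "continuous_on UNIV (\<lambda>b. (D b)\<^sup>2)" "continuous_on UNIV (\<lambda>b. (D (relabel (\<gamma> m) b))\<^sup>2)"
        "continuous_on UNIV (\<lambda>b. D b * D (relabel (\<gamma> m) b))"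
      by (intro continuous_intros Dc cont_relabel)+
    have "?A (\<lambda>b. (F' b - c)\<^sup>2) =
        ?A (\<lambda>b. (1 / 4) * ((D b)\<^sup>2 + (D (relabel (\<gamma> m) b))\<^sup>2 + 2 * (D b * D (relabel (\<gamma> m) b))))"
      by (rule arg_cong[of _ _ ?A]) (auto simp: F'_def D_def power2_eq_square algebra_simps)
    also have "\<dots> = (1 / 4) * (?A (\<lambda>b. (D b)\<^sup>2) + ?A (\<lambda>b. (D (relabel (\<gamma> m) b))\<^sup>2) +
        2 * ?A (\<lambda>b. D b * D (relabel (\<gamma> m) b)))"
    proof -
      have c2: "continuous_on UNIV (\<lambda>b. 2 * (D b * D (relabel (\<gamma> m) b)))"
          "continuous_on UNIV (\<lambda>b. (D b)\<^sup>2 + (D (relabel (\<gamma> m) b))\<^sup>2)"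
        by (intro continuous_intros Dc cont_relabel)+
      show ?thesis
        by (simp only: L.scale[OF continuous_on_add[OF c2(2,1)]] L.add[OF c2(2,1)] L.add[OF c1(1,2)]
            L.scale[OF c1(3)])
    qed
    also have "?A (\<lambda>b. (D (relabel (\<gamma> m) b))\<^sup>2) = ?A (\<lambda>b. (D b)\<^sup>2)"
      using state_invariant[OF L \<gamma>_in_G c1(1)] by simp
    also have "?A (\<lambda>b. D b * D (relabel (\<gamma> m) b)) = 0"
      using ind F(1) D A_D unfolding generically_independent_def m_def by simp
    finally show ?thesis
      using F(4) by (simp add: D_def)
  qed
  ultimately show ?case
    using F(1) unfolding c_def by (intro exI[of _ "S' \<union> \<gamma> m ` S'"] exI[of _ F']) auto
qed

text \<open>
  If \<open>\<Lambda> = (1 - u) a + u c\<close>, then \<open>(1 - u) a \<le> \<Lambda>\<close>, so functions with small \<open>\<Lambda>\<close>-variance around the mean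
  \<open>m = \<Lambda> f\<close> also have \<open>a\<close>-mean close to \<open>m\<close>. Applied to the averages from \<open>variance_halving\<close>, whose
  \<open>a\<close>-mean is \<open>a f\<close>, this gives \<open>a f = \<Lambda> f\<close>.
\<close>

lemma generically_independent_imp_extreme:
  assumes L: "\<Lambda> \<in> states" and ind: "generically_independent \<Lambda>"
  shows "\<Lambda> extreme_point_of states"
  unfolding extreme_point_of_def
proof (intro conjI L ballI notI)
  fix a c assume a: "a \<in> states" and c: "c \<in> states" and seg: "\<Lambda> \<in> open_segment a c"
  obtain u where u: "0 < u" "u < 1" "\<Lambda> = (1 - u) *\<^sub>R a + u *\<^sub>R c"
    using seg by (auto simp: in_segment)
  interpret a: positive_functional "apply_functional a"
    by (rule state_positive[OF a])
  have "a = \<Lambda>"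
  proof (rule states_eqI[OF a L])
    fix S f assume f: "finite S" "cylinder S (f :: ('i \<Rightarrow> 'b) \<Rightarrow> real)"
    define m where "m = apply_functional \<Lambda> f"
    define V where "V = apply_functional \<Lambda> (\<lambda>b. (f b - m)\<^sup>2) / (1 - u)"
    have le: "(apply_functional a f - m)\<^sup>2 \<le> V / 2 ^ n" for n
    proof -
      obtain S' F where F: "finite S'" "cylinder S' F"
          "\<And>\<Lambda>'. \<Lambda>' \<in> states \<Longrightarrow> apply_functional \<Lambda>' F = apply_functional \<Lambda>' f"
          "apply_functional \<Lambda> (\<lambda>b. (F b - m)\<^sup>2) = apply_functional \<Lambda> (\<lambda>b. (f b - m)\<^sup>2) / 2 ^ n"
        using variance_halving[OF L ind f, of n] unfolding m_def by blast
      note Fc = cylinderD(1)[OF F(2)]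
      define s where "s = apply_functional a f - m"
      have c1: "continuous_on UNIV (\<lambda>b. (F b - m)\<^sup>2)" "continuous_on UNIV (\<lambda>b. 2 * s * (F b - m))"
          "continuous_on UNIV (\<lambda>b. F b - m)" "continuous_on UNIV (\<lambda>b. (F b - m)\<^sup>2 - 2 * s * (F b - m))"
        by (intro continuous_intros Fc)+
      have aF: "apply_functional a (\<lambda>b. F b - m) = s"
        using a.diff[OF Fc, of "\<lambda>_. m"] a.const[of m] invariant_statesD(2)[OF a] F(3)[OF a]
        by (simp add: s_def)
      \<comment> \<open>Jensen's inequality for the square: \<open>s\<^sup>2 \<le> a ((F - m)\<^sup>2)\<close>, as \<open>s\<close> is the \<open>a\<close>-mean of \<open>F - m\<close>.\<close>
      have "0 \<le> apply_functional a (\<lambda>b. (F b - m - s)\<^sup>2)"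
        by (intro a.nonneg continuous_intros Fc) simp
      also have "\<dots> = apply_functional a (\<lambda>b. (F b - m)\<^sup>2 - 2 * s * (F b - m) + s\<^sup>2)"
        by (rule arg_cong[of _ _ "apply_functional a"]) (auto simp: power2_eq_square algebra_simps)
      also have "\<dots> = apply_functional a (\<lambda>b. (F b - m)\<^sup>2) - s\<^sup>2"
        using a.add[OF c1(4), of "\<lambda>_. s\<^sup>2"] a.diff[OF c1(1,2)] a.scale[OF c1(3), of "2 * s"] aF
          a.const[of "s\<^sup>2"] invariant_statesD(2)[OF a] by (simp add: power2_eq_square)
      finally have "(1 - u) * s\<^sup>2 \<le> (1 - u) * apply_functional a (\<lambda>b. (F b - m)\<^sup>2)"
        using u by (intro mult_left_mono) auto
      also have "\<dots> \<le> (1 - u) * apply_functional a (\<lambda>b. (F b - m)\<^sup>2) + u * apply_functional c (\<lambda>b. (F b - m)\<^sup>2)"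
        using u invariant_cone_nonneg[OF invariant_statesD(1)[OF c] c1(1)] by simp
      also have "\<dots> = apply_functional \<Lambda> (\<lambda>b. (F b - m)\<^sup>2)"
        by (simp add: u(3))
      finally show ?thesis
        using u(1,2) by (simp add: F(4) V_def s_def pos_le_divide_eq mult_ac)
    qed
    have "(\<lambda>n. V * (1 / 2) ^ n) \<longlonglongrightarrow> V * 0"
      by (intro tendsto_intros LIMSEQ_power_zero) simp
    then have "(apply_functional a f - m)\<^sup>2 \<le> V * 0"
      using le by (intro LIMSEQ_le_const[of "\<lambda>n. V * (1 / 2) ^ n"]) (auto simp: power_divide)
    then show "apply_functional a f = apply_functional \<Lambda> f"
      by (simp add: m_def)
  qed
  with seg show False by (simp add: open_segment_def)
qed

lemma closedin_extreme_states: "closedin vague_topology {\<Lambda>. \<Lambda> extreme_point_of states}"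
proof -
  have closed_eq: "closedin vague_topology {\<Lambda>. apply_functional \<Lambda> f = apply_functional \<Lambda> g * apply_functional \<Lambda> h}"
    for f g h :: "('i \<Rightarrow> 'b) \<Rightarrow> real"
  proof -
    have "continuous_map vague_topology euclideanreal
        (\<lambda>\<Lambda>. apply_functional \<Lambda> f - apply_functional \<Lambda> g * apply_functional \<Lambda> h)"
      by (intro continuous_map_diff continuous_map_real_mult continuous_map_apply_functional)
    from closedin_continuous_map_preimage[OF this, of "{0}"] show ?thesis
      by (simp add: strong_operator_topology_topspace)
  qed
  define I where "I = {(S, f, g, m). finite S \<and> cylinder S (f :: ('i \<Rightarrow> 'b) \<Rightarrow> real) \<and>
      cylinder S (g :: ('i \<Rightarrow> 'b) \<Rightarrow> real) \<and> threshold S \<le> m}"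
  have "{\<Lambda>. \<Lambda> extreme_point_of states} = states \<inter>
      (\<Inter>(S, f, g, m)\<in>I. {\<Lambda>. apply_functional \<Lambda> (\<lambda>b. f b * g (relabel (\<gamma> m) b)) =
        apply_functional \<Lambda> f * apply_functional \<Lambda> g})"
    using extreme_imp_generically_independent generically_independent_imp_extreme
    by (auto simp: I_def generically_independent_def extreme_point_of_def[of _ states])
  moreover have "closedin vague_topology states"
    by (intro compactin_imp_closedin compactin_invariant_states Hausdorff_strong_operator_topology)
  moreover have "closedin vague_topology
      (\<Inter>(S, f, g, m)\<in>I. {\<Lambda>. apply_functional \<Lambda> (\<lambda>b. f b * g (relabel (\<gamma> m) b)) =
        apply_functional \<Lambda> f * apply_functional \<Lambda> g})"
  proof (rule closedin_INT)
    have "({}, \<lambda>_. 0, \<lambda>_. 0, threshold {}) \<in> I"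
      by (simp add: I_def cylinder_const)
    then show "I \<noteq> {}" by blast
  qed (auto intro: closed_eq)
  ultimately show ?thesis by (simp add: closedin_Int)
qed

text \<open>
  By \<open>image_integral_functional\<close> the measures are the states for the relabelling homeomorphisms.
\<close>

theorem bauer_simplex_exchangeable:
  "bauer_simplex vague_topology
     (integral_functional ` {\<mu> :: ('i \<Rightarrow> 'b) measure. prob_space \<mu> \<and> sets \<mu> = sets borel \<and>
        (\<forall>g\<in>G. distr \<mu> borel (relabel g) = \<mu>)})"
proof -
  have "{\<mu> :: ('i \<Rightarrow> 'b) measure. prob_space \<mu> \<and> sets \<mu> = sets borel \<and>
        (\<forall>g\<in>G. distr \<mu> borel (relabel g) = \<mu>)} =
      {\<mu>. prob_space \<mu> \<and> sets \<mu> = sets borel \<and> (\<forall>t\<in>T. distr \<mu> borel t = \<mu>)}"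
    by (auto simp: T_def)
  then show ?thesis
    using choquet_simplex_invariant_states[OF states_nonempty] closedin_extreme_states
    by (simp add: bauer_simplex_def image_integral_functional)
qed

end

section \<open>General position under affine maps\<close>

interpretation F2: vector_space f2_scale
  by (rule vector_space_f2_scale)

interpretation F2_pair: vector_space_pair f2_scale f2_scale
  by unfold_locales

definition unit_vec :: "nat \<Rightarrow> f2_omega" where
  "unit_vec k = Poly_Mapping.single k 1"

lemma lookup_unit_vec: "Poly_Mapping.lookup (unit_vec k) i = (if i = k then 1 else 0)"
  by (simp add: unit_vec_def lookup_single when_def)

lemma inj_unit_vec: "inj unit_vec"
  by (rule injI) (metis lookup_unit_vec zero_neq_one)

lemma add_self_f2: "v + v = (0 :: f2_omega)"
proof (rule poly_mapping_eqI)
  fix k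
  have "a + a = 0" for a :: bit
    by (cases a) auto
  then show "Poly_Mapping.lookup (v + v) k = Poly_Mapping.lookup (0 :: f2_omega) k"
    by (simp only: lookup_add lookup_zero)
qed

lemma in_span_unit_vec:
  assumes "Poly_Mapping.keys v \<subseteq> {..<n}" shows "v \<in> F2.span (unit_vec ` {..<n})"
proof -
  have "v = (\<Sum>k<n. f2_scale (Poly_Mapping.lookup v k) (unit_vec k))"
  proof (rule poly_mapping_eqI)
    fix i
    have "Poly_Mapping.lookup v i = 0" if "\<not> i < n"
      using that assms by (metis in_keys_iff lessThan_iff subsetD)
    then show "Poly_Mapping.lookup v i =
        Poly_Mapping.lookup (\<Sum>k<n. f2_scale (Poly_Mapping.lookup v k) (unit_vec k)) i"
      by (simp add: lookup_sum lookup_unit_vec sum.delta if_distrib cong: if_cong)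
  qed
  also have "\<dots> \<in> F2.span (unit_vec ` {..<n})"
    by (intro F2.span_sum F2.span_scale F2.span_base) auto
  finally show ?thesis .
qed

lemma finite_subset_span_unit_vec:
  assumes "finite S" obtains n where "S \<subseteq> F2.span (unit_vec ` {..<n})"
proof -
  have "finite (\<Union>v\<in>S. Poly_Mapping.keys v)"
    using assms by simp
  then obtain n where "(\<Union>v\<in>S. Poly_Mapping.keys v) \<subseteq> {..<n}"
    using finite_nat_bounded by blast
  then have "S \<subseteq> F2.span (unit_vec ` {..<n})"
    by (intro subsetI in_span_unit_vec) blast
  then show thesis by (rule that)
qed

lemma finite_lookup_bounded:
  assumes "finite (S :: f2_omega set)"
  obtains N where "\<And>v k. v \<in> S \<Longrightarrow> N \<le> k \<Longrightarrow> Poly_Mapping.lookup v k = 0"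
proof -
  have "finite (\<Union>v\<in>S. Poly_Mapping.keys v)"
    using assms by simp
  then obtain N where "(\<Union>v\<in>S. Poly_Mapping.keys v) \<subseteq> {..<N}"
    using finite_nat_bounded by blast
  then have "Poly_Mapping.lookup v k = 0" if "v \<in> S" "N \<le> k" for v k
    using that by (metis UN_I in_keys_iff lessThan_iff not_less subsetD)
  then show thesis by (rule that)
qed

text \<open>
  All independence statements below reduce to triangularity: each new vector involves a
  coordinate that does not occur in the earlier ones.
\<close>

lemma independent_insert_fresh:
  assumes "F2.independent S" "\<And>v. v \<in> S \<Longrightarrow> Poly_Mapping.lookup v k = 0" "Poly_Mapping.lookup a k \<noteq> 0"
  shows "F2.independent (insert a S)"
proof (rule F2.independent_insertI[OF _ assms(1)])
  have "F2.span S \<subseteq> {v. Poly_Mapping.lookup v k = 0}"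
    using assms(2) by (intro F2.span_minimal F2.subspaceI) (auto simp: lookup_add)
  then show "a \<notin> F2.span S"
    using assms(3) by blast
qed

lemma independent_unit_vec:
  assumes "finite K" shows "F2.independent (unit_vec ` K)"
  using assms
proof induction
  case (insert k K)
  then have "F2.independent (insert (unit_vec k) (unit_vec ` K))"
    by (intro independent_insert_fresh[of _ k]) (auto simp: lookup_unit_vec)
  then show ?case by simp
qed (simp add: F2.independent_empty)

lemma infinite_basis_f2:
  assumes "F2.span A = UNIV" shows "infinite A"
proof
  assume fin: "finite A"
  have "card (unit_vec ` {..card A}) \<le> card A"
    using F2.independent_span_bound[OF fin independent_unit_vec[of "{..card A}"]] assms by simp
  moreover have "card (unit_vec ` {..card A}) = Suc (card A)"
    using card_image[OF inj_on_subset[OF inj_unit_vec]] by simp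
  ultimately show False by simp
qed

text \<open>
  Extend both families to bases. Since the space has countably infinite dimension, finite families
  have countably infinite complements in these bases, and the complements can be matched up.
\<close>

lemma extend_to_linear_bijection:
  fixes x y :: "'i \<Rightarrow> f2_omega"
  assumes I: "finite I" and x: "inj_on x I" "F2.independent (x ` I)"
    and y: "inj_on y I" "F2.independent (y ` I)"
  obtains L where "Vector_Spaces.linear f2_scale f2_scale L" "bij L" "\<And>i. i \<in> I \<Longrightarrow> L (x i) = y i"
proof -
  define A where "A = F2.extend_basis (x ` I)"
  define B where "B = F2.extend_basis (y ` I)"
  have A: "x ` I \<subseteq> A" "F2.independent A" "F2.span A = UNIV"
    unfolding A_def using F2.extend_basis_superset F2.independent_extend_basis F2.span_extend_basis x by auto
  have B: "y ` I \<subseteq> B" "F2.independent B" "F2.span B = UNIV"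
    unfolding B_def using F2.extend_basis_superset F2.independent_extend_basis F2.span_extend_basis y by auto
  have inf: "infinite (A - x ` I)" "infinite (B - y ` I)"
    using infinite_basis_f2 A(3) B(3) I by (auto simp: Diff_infinite_finite)
  have "bij_betw (from_nat_into (B - y ` I) \<circ> to_nat_on (A - x ` I)) (A - x ` I) (B - y ` I)"
    using inf by (intro bij_betw_trans[of _ _ UNIV] to_nat_on_infinite bij_betw_from_nat_into) auto
  then obtain p where p: "bij_betw p (A - x ` I) (B - y ` I)" by blast
  define q where "q = y \<circ> the_inv_into I x"
  have qx: "q (x i) = y i" if "i \<in> I" for i
    using that x(1) by (simp add: q_def the_inv_into_f_f)
  have q: "bij_betw q (x ` I) (y ` I)"
    unfolding q_def using x(1) y(1)
    by (intro bij_betw_trans[of _ _ I] bij_betw_the_inv_into bij_betw_imageI refl)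
  define f where "f v = (if v \<in> x ` I then q v else p v)" for v
  have "bij_betw f (x ` I \<union> (A - x ` I)) (y ` I \<union> (B - y ` I))"
    unfolding f_def using q p by (rule bij_betw_disjoint_Un) auto
  then have f: "bij_betw f A B"
    using A(1) B(1) by (simp add: Un_absorb1)
  define L where "L = F2_pair.construct A f"
  have lin: "Vector_Spaces.linear f2_scale f2_scale L"
    unfolding L_def by (rule F2_pair.linear_construct[OF A(2)])
  interpret L: Vector_Spaces.linear f2_scale f2_scale L by (rule lin)
  have Lb: "L v = f v" if "v \<in> A" for v
    unfolding L_def by (rule F2_pair.construct_basis[OF A(2) that])
  have im: "L ` A = B" "inj_on L A"
    using f Lb unfolding bij_betw_def by (auto simp: inj_on_def)
  have "inj_on L (F2.span A)"
    using im B(2) by (intro L.inj_on_span_independent_image) simp_all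
  moreover have "range L = UNIV"
    using L.span_image[of A] A(3) B(3) im(1) by simp
  ultimately have "bij L"
    using A(3) by (simp add: bij_def)
  moreover have "L (x i) = y i" if "i \<in> I" for i
    using that A(1) Lb[of "x i"] qx[OF that] by (auto simp: f_def)
  ultimately show thesis using lin that by blast
qed

text \<open>
  With \<open>L = id\<close> and \<open>c = 0\<close>, these vectors span the first \<open>n\<close> coordinates together with their generic
  copy near position \<open>m\<close>: index \<open>n\<close> is the base point of the copy and the later indices are its
  directions. For general \<open>L\<close> and \<open>c\<close> they are the values that the linear part of an affine map with
  translation part \<open>c\<close> must take there in order to extend \<open>v \<mapsto> L v + c\<close> and to send one generic
  copy to another.
\<close>

definition frame :: "nat \<Rightarrow> (f2_omega \<Rightarrow> f2_omega) \<Rightarrow> f2_omega \<Rightarrow> nat \<Rightarrow> nat \<Rightarrow> f2_omega" where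
  "frame n L c m i =
     (if i < n then L (unit_vec i) else unit_vec (m + (i - n)) + (if i = n then c else 0))"

lemma independent_frame:
  assumes L: "Vector_Spaces.linear f2_scale f2_scale L" "inj L"
    and small: "\<And>i k. i < n \<Longrightarrow> m \<le> k \<Longrightarrow> Poly_Mapping.lookup (L (unit_vec i)) k = 0"
      "\<And>k. m \<le> k \<Longrightarrow> Poly_Mapping.lookup c k = 0"
  shows "inj_on (frame n L c m) {..<n + j} \<and> F2.independent (frame n L c m ` {..<n + j})"
proof (induction j)
  case 0
  interpret L: Vector_Spaces.linear f2_scale f2_scale L by (rule L(1))
  have im: "frame n L c m ` {..<n} = L ` unit_vec ` {..<n}"
    by (force simp: frame_def)
  have "F2.independent (L ` unit_vec ` {..<n})"
    by (intro L.independent_injective_image independent_unit_vec inj_on_subset[OF L(2)]) auto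
  moreover have "inj_on (frame n L c m) {..<n}"
    using injD[OF L(2)] injD[OF inj_unit_vec] by (auto simp: inj_on_def frame_def)
  ultimately show ?case using im by simp
next
  case (Suc j)
  have new: "Poly_Mapping.lookup (frame n L c m (n + j)) (m + j) \<noteq> 0"
    by (simp add: frame_def lookup_add lookup_unit_vec small(2))
  have old: "Poly_Mapping.lookup (frame n L c m i) (m + j) = 0" if "i < n + j" for i
    using that by (auto simp: frame_def lookup_add lookup_unit_vec small)
  have "frame n L c m (n + j) \<notin> frame n L c m ` {..<n + j}"
    using new old by auto
  moreover have "F2.independent (insert (frame n L c m (n + j)) (frame n L c m ` {..<n + j}))"
    using Suc new old by (intro independent_insert_fresh[of _ "m + j"]) auto
  ultimately show ?case
    using Suc by (simp add: lessThan_Suc)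
qed

text \<open>
  A linear bijection shifting the first \<open>m\<close> unit vectors by \<open>m + 1\<close> places. Position \<open>m\<close> itself is left
  free for the translation in \<open>generic_affine\<close>.
\<close>

definition shift_map :: "nat \<Rightarrow> f2_omega \<Rightarrow> f2_omega" where
  "shift_map m = (SOME L. Vector_Spaces.linear f2_scale f2_scale L \<and> bij L \<and>
     (\<forall>i<m. L (unit_vec i) = unit_vec (m + 1 + i)))"

lemma shift_map:
  "Vector_Spaces.linear f2_scale f2_scale (shift_map m)" "bij (shift_map m)"
  "i < m \<Longrightarrow> shift_map m (unit_vec i) = unit_vec (m + 1 + i)"
proof -
  have "F2.independent ((\<lambda>i. unit_vec (m + 1 + i)) ` {..<m})"
    using independent_unit_vec[of "(\<lambda>i. m + 1 + i) ` {..<m}"] by (simp add: image_image)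
  moreover have "inj_on (\<lambda>i. unit_vec (m + 1 + i)) {..<m}"
    by (auto intro!: inj_onI dest: injD[OF inj_unit_vec])
  ultimately obtain L where "Vector_Spaces.linear f2_scale f2_scale L" "bij L"
      "\<And>i. i \<in> {..<m} \<Longrightarrow> L (unit_vec i) = unit_vec (m + 1 + i)"
    using extend_to_linear_bijection[OF finite_lessThan inj_on_subset[OF inj_unit_vec subset_UNIV]
        independent_unit_vec[OF finite_lessThan]] by metis
  then have "\<exists>L. Vector_Spaces.linear f2_scale f2_scale L \<and> bij L \<and>
     (\<forall>i<m. L (unit_vec i) = unit_vec (m + 1 + i))"
    by auto
  from someI_ex[OF this]
  show "Vector_Spaces.linear f2_scale f2_scale (shift_map m)" "bij (shift_map m)"
    "i < m \<Longrightarrow> shift_map m (unit_vec i) = unit_vec (m + 1 + i)"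
    unfolding shift_map_def[symmetric] by auto
qed

text \<open>
  The translation moves \<open>0\<close> as well. A linear choice would fix \<open>0\<close>, and then no \<open>h\<close> could map
  \<open>0 = generic_affine m 0\<close> to \<open>0 = generic_affine m' 0\<close> and agree at \<open>0\<close> with an affine \<open>\<sigma>\<close> that moves \<open>0\<close>.
\<close>

definition generic_affine :: "nat \<Rightarrow> f2_omega \<Rightarrow> f2_omega" where
  "generic_affine m v = shift_map m v + unit_vec m"

lemma affine_in_aff:
  assumes "Vector_Spaces.linear f2_scale f2_scale L" "bij L"
  shows "(\<lambda>v. L v + c) \<in> aff_f2_omega"
proof -
  have "bij ((\<lambda>v. v + c) \<circ> L)"
    by (intro bij_comp assms(2) bij_plus_right)
  then show ?thesis
    using assms(1) unfolding aff_f2_omega_def by (auto simp: comp_def)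
qed

text \<open>
  The affine span of the first \<open>n\<close> unit vectors and \<open>0\<close>, together with its image under \<open>generic_affine m\<close>, has
  as a frame the origin and \<open>2 n + 1\<close> independent vectors, listed by \<open>frame n id 0 m\<close>. As soon as \<open>m'\<close> exceeds
  all coordinates in the image of this span under \<open>\<sigma> = (\<lambda>v. L v + c)\<close>, the required values
  \<open>frame n L c m'\<close> of the linear part of \<open>h\<close> are independent as well, so \<open>h\<close> exists. The base point needs
  the correction \<open>c\<close> because \<open>h\<close> adds \<open>c\<close> again and \<open>c + c = 0\<close>.
\<close>

lemma generic_affine_general_position:
  assumes S: "finite S" and \<sigma>: "\<sigma> \<in> aff_f2_omega"
  shows "\<exists>M. \<forall>m\<ge>M. \<forall>m'\<ge>M. \<exists>h\<in>aff_f2_omega. \<forall>v\<in>S.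
    h v = \<sigma> v \<and> h (generic_affine m v) = generic_affine m' v"
proof -
  obtain L c where L: "Vector_Spaces.linear f2_scale f2_scale L" and \<sigma>_eq: "\<sigma> = (\<lambda>v. L v + c)" and "bij \<sigma>"
    using \<sigma> by (auto simp: aff_f2_omega_def)
  have "inj L"
    using bij_is_inj[OF \<open>bij \<sigma>\<close>] by (auto simp: \<sigma>_eq inj_def)
  obtain n where n: "S \<subseteq> F2.span (unit_vec ` {..<n})"
    using finite_subset_span_unit_vec[OF S] .
  obtain N where N: "\<And>v k. v \<in> insert c (L ` unit_vec ` {..<n}) \<Longrightarrow> N \<le> k \<Longrightarrow> Poly_Mapping.lookup v k = 0"
    by (rule finite_lookup_bounded[of "insert c (L ` unit_vec ` {..<n})"]) auto
  have "\<exists>h\<in>aff_f2_omega. \<forall>v\<in>S. h v = \<sigma> v \<and> h (generic_affine m v) = generic_affine m' v"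
    if m: "m \<ge> max n N" "m' \<ge> max n N" for m m'
  proof -
    let ?x = "frame n id 0 m" and ?y = "frame n L c m'"
    have "inj_on ?x {..<n + Suc n} \<and> F2.independent (?x ` {..<n + Suc n})"
      using m by (intro independent_frame F2.linear_id) (auto simp: lookup_unit_vec)
    moreover have "inj_on ?y {..<n + Suc n} \<and> F2.independent (?y ` {..<n + Suc n})"
      using m N by (intro independent_frame L \<open>inj L\<close>) auto
    ultimately obtain H where H: "Vector_Spaces.linear f2_scale f2_scale H" "bij H"
        and Hxy: "\<And>i. i \<in> {..<n + Suc n} \<Longrightarrow> H (?x i) = ?y i"
      using extend_to_linear_bijection[of "{..<n + Suc n}" ?x ?y] by blast
    interpret H: Vector_Spaces.linear f2_scale f2_scale H by (rule H(1))
    have H_low: "H (unit_vec i) = L (unit_vec i)" if "i < n" for i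
      using Hxy[of i] that by (simp add: frame_def)
    have H_mid: "H (unit_vec m) = unit_vec m' + c"
      using Hxy[of n] by (simp add: frame_def)
    have H_high: "H (unit_vec (m + 1 + i)) = unit_vec (m' + 1 + i)" if "i < n" for i
      using Hxy[of "n + 1 + i"] that by (simp add: frame_def)
    have HL: "H v = L v" if "v \<in> S" for v
      using F2_pair.linear_eq_on_span[OF H(1) L, of "unit_vec ` {..<n}" v] H_low that n by auto
    have HS: "H (shift_map m v) = shift_map m' v" if "v \<in> S" for v
    proof -
      have "Vector_Spaces.linear f2_scale f2_scale (H \<circ> shift_map m)"
        using shift_map(1) H(1) by (rule Vector_Spaces.linear_compose)
      moreover have "(H \<circ> shift_map m) w = shift_map m' w" if "w \<in> unit_vec ` {..<n}" for w
        using that m H_high by (auto simp: shift_map(3))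
      ultimately have "(H \<circ> shift_map m) v = shift_map m' v"
        using F2_pair.linear_eq_on_span[OF _ shift_map(1)] subsetD[OF n \<open>v \<in> S\<close>] by blast
      then show ?thesis by simp
    qed
    have "H v + c = \<sigma> v \<and> H (generic_affine m v) + c = generic_affine m' v" if "v \<in> S" for v
      using HL[OF that] HS[OF that] H_mid
      by (simp add: generic_affine_def H.add \<sigma>_eq add.assoc add_self_f2)
    then show ?thesis
      by (intro bexI[OF _ affine_in_aff[OF H, of c]] ballI) simp
  qed
  then show ?thesis
    by (intro exI[of _ "max n N"] allI impI)
qed

section \<open>Affine-exchangeable measures\<close>

theorem theorem1p6:
  assumes "compact (UNIV :: 'b::metric_space set)"
  shows "bauer_simplex vague_topology
           (integral_functional ` (affine_exchangeable :: (f2_omega \<Rightarrow> 'b) measure set))"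
proof -
  have "id \<in> aff_f2_omega"
    using affine_in_aff[OF F2.linear_id bij_id, of 0] by (simp add: id_def)
  moreover have "generic_affine m \<in> aff_f2_omega" for m
    using affine_in_aff[OF shift_map(1,2), of m "unit_vec m"] by (simp add: generic_affine_def[abs_def])
  ultimately have "generic_relabelling TYPE('b) aff_f2_omega generic_affine"
    using assms generic_affine_general_position
    by (intro generic_relabelling.intro) (auto simp: aff_f2_omega_def)
  from generic_relabelling.bauer_simplex_exchangeable[OF this] show ?thesis
    by (simp add: affine_exchangeable_def relabel_def[abs_def])
qed

end
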